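(* The complete set of eigenpolynomials of the multivariate Hahn system $\widetilde{\mathcal H}_T=\widetilde{\mathcal H}_0+\widetilde{\mathcal H}_1$ is, for $\boldsymbol m=(m_0,m_1,\ldots,m_{n-1})\in\mathcal X$, $$\mathcal P_{\boldsymbol m}(\boldsymbol x;\boldsymbol a,b,N)=\prod_{i=1}^{n-1}\mathcal P^{(i)}_{m_i}\Bigl(x_i,\;x_{>i}-\sum_{j=i+1}^{n-1}m_j;\;a_i,\;a_{>i}+2\sum_{j=i+1}^{n-1}m_j\Bigr)\times H_{m_0}\Bigl(|x|-\sum_{j=1}^{n-1}m_j;\;|a|+2\sum_{j=1}^{n-1}m_j,\;b,\;N-\sum_{j=1}^{n-1}m_j\Bigr),$$ that is, explicitly, $$\mathcal P_{\boldsymbol m}=\prod_{i=1}^{n-1}\Biggl(\sum_{k=0}^{m_i}(-1)^k\binom{m_i}{k}\Bigl(a_{>i}+2\sum_{j=i+1}^{n-1}m_j+k\Bigr)_{m_i-k}(a_i+m_i-k)_k\,(-x_i)_{m_i-k}\Bigl(-x_{>i}+\sum_{j=i+1}^{n-1}m_j\Bigr)_k\Biggr)$$ $$\qquad\times{}_3F_2\left(\begin{matrix}-m_0,\ m_0+2\sum_{j=1}^{n-1}m_j+|a|+b-1,\ -|x|+\sum_{j=1}^{n-1}m_j\\ |a|+2\sum_{j=1}^{n-1}m_j,\ -N+\sum_{j=1}^{n-1}m_j\end{matrix}\,\Bigm|\,1\right).$$ With $|m|=m_0+m_1+\cdots+m_{n-1}$, they satisfy $$\widetilde{\mathcal H}_T\mathcal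 P_{\boldsymbol m}=|m|\bigl(|m|+|a|+b-1\bigr)\mathcal P_{\boldsymbol m},$$ $$\widetilde{\mathcal H}_i\mathcal P_{\boldsymbol m}=|m|\Bigl(|m|+\sum_{j=i}^na_j-1\Bigr)\mathcal P_{\boldsymbol m},\qquad i=1,\ldots,n-1,$$ $$(\mathcal P_{\boldsymbol m},\mathcal P_{\boldsymbol m'})=0,\qquad \boldsymbol m\ne\boldsymbol m',\quad \boldsymbol m,\boldsymbol m'\in\mathcal X.$$
   Context: Fix integers $N>n\ge2$ and real parameters $a_1,\ldots,a_n>0$, $b>0$; $\boldsymbol a=(a_1,\ldots,a_n)$, $|a|=\sum_{i=1}^na_i$. For $\boldsymbol x=(x_1,\ldots,x_n)$ let $|x|=\sum_{i=1}^nx_i$; $\mathcal X=\{\boldsymbol x\in\mathbb N_0^n: |x|\le N\}$. For $1\le i\le n-1$: $x_{>i}=x_{i+1}+\cdots+x_n$, $a_{>i}=a_{i+1}+\cdots+a_n$. $(c)_k=c(c+1)\cdots(c+k-1)$, $(c)_0=1$. Empty sums are $0$. $V_N(\boldsymbol x)$ is the space of real polynomials in $x_1,\ldots,x_n$ of total degree $\le N$. "Complete set" means that the eigenpolynomials form a basis of $V_N(\boldsymbol x)$ (equivalently, of the space of real functions on $\mathcal X$). Difference operators acting on polynomials ($\boldsymbol e_j$ the $j$-th unit vector): $\widetilde{\mathcal H}_T=\widetilde{\mathcal H}_0+\widetilde{\mathcal H}_1$ with $$\widetilde{\mathcal H}_0 p(\boldsymbol x)=\sum_{j=1}^n(N-|x|)(x_j+a_j)\bigl(p(\boldsymbol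 x)-p(\boldsymbol x+\boldsymbol e_j)\bigr)+\sum_{j=1}^nx_j(N-|x|+b)\bigl(p(\boldsymbol x)-p(\boldsymbol x-\boldsymbol e_j)\bigr),$$ $$\widetilde{\mathcal H}_ip(\boldsymbol x)=\sum_{\substack{i\le j,k\le n\\ j\ne k}}x_j(x_k+a_k)\bigl(p(\boldsymbol x)-p(\boldsymbol x-\boldsymbol e_j+\boldsymbol e_k)\bigr),\quad i=1,\ldots,n-1.$$ Weight and inner product: $$W(\boldsymbol x)=\frac{N!}{x_1!\cdots x_n!\,(N-|x|)!}\,\frac{\prod_{i=1}^n(a_i)_{x_i}\,(b)_{N-|x|}}{(|a|+b)_N},\qquad (p,q)=\sum_{\boldsymbol x\in\mathcal X}p(\boldsymbol x)q(\boldsymbol x)W(\boldsymbol x).$$ Single variable Hahn polynomial: $H_m(x;a,b,N)={}_3F_2\left(\begin{matrix}-m,\ m+a+b-1,\ -x\\ a,\ -N\end{matrix}\Bigm|1\right)=\sum_{k=0}^m\frac{(-m)_k(m+a+b-1)_k(-x)_k}{(a)_k(-N)_k\,k!}$ (the $_3F_2$ in the claim likewise denotes the sum over $0\le k\le m_0$). Type two polynomials (the superscript $(i)$ is only a label for the pair of variables used): $\mathcal P^{(i)}_m(u,v;\alpha,\gamma)=\sum_{k=0}^m(-1)^k\binom mk(\gamma+k)_{m-k}(\alpha+m-k)_k(-u)_{m-k}(-v)_k$.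
   Formalization: In the eigenvalue of H_i, |m| is replaced by the partial sum m_i+...+m_{n-1}; as printed the formula fails for m=(1,0,...,0), where P_m depends only on |x| and H_i P_m=0 although the printed eigenvalue is a_i+...+a_n>0. *)

theory Defs
  imports "HOL-Analysis.Analysis" "HOL-Library.Function_Algebras"
begin

text \<open>
  An \<open>n\<close>-tuple is a function on \<open>nat\<close> of which only the entries with index in a finite set \<open>I\<close>
  matter: \<open>I = {1..n}\<close> for the variables \<open>x\<close> and the parameters \<open>a\<close>, and \<open>I = {..<n}\<close> for the
  labels \<open>m = (m 0, \<dots>, m (n - 1))\<close>. In lattice points the entries outside \<open>I\<close> are fixed to be
  \<open>0\<close>, so that distinct functions are distinct tuples and the set below is finite.
\<close>

definition lattice_simplex :: "nat set \<Rightarrow> nat \<Rightarrow> (nat \<Rightarrow> nat) set" where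
  "lattice_simplex I N = {x. (\<forall>i. i \<notin> I \<longrightarrow> x i = 0) \<and> (\<Sum>i\<in>I. x i) \<le> N}"


text \<open>
  A real polynomial in \<open>x 1, \<dots>, x n\<close> is represented by the function it induces, which is
  faithful because the field is infinite.
\<close>

type_synonym mfun = "(nat \<Rightarrow> real) \<Rightarrow> real"

definition fscale :: "real \<Rightarrow> mfun \<Rightarrow> mfun" where
  "fscale c f = (\<lambda>x. c * f x)"

global_interpretation fun_space: vector_space fscale
  by unfold_locales (auto simp: fscale_def fun_eq_iff algebra_simps)

definition poly_space :: "nat \<Rightarrow> nat \<Rightarrow> mfun set" where
  "poly_space n N =
     {p. \<exists>c :: (nat \<Rightarrow> nat) \<Rightarrow> real.
           p = (\<lambda>x. \<Sum>\<alpha>\<in>lattice_simplex {1..n} N. c \<alpha> * (\<Prod>i=1..n. x i ^ \<alpha> i))}"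


definition H0_op :: "nat \<Rightarrow> nat \<Rightarrow> (nat \<Rightarrow> real) \<Rightarrow> real \<Rightarrow> mfun \<Rightarrow> mfun" where
  "H0_op n N a b p = (\<lambda>x.
     (\<Sum>j=1..n. (real N - (\<Sum>l=1..n. x l)) * (x j + a j) * (p x - p (x(j := x j + 1))))
   + (\<Sum>j=1..n. x j * (real N - (\<Sum>l=1..n. x l) + b) * (p x - p (x(j := x j - 1)))))"

text \<open>
  \<open>H_op n a i\<close> only moves \<open>x i, \<dots>, x n\<close> and preserves their sum. Hence its eigenvalue on
  \<open>multi_hahn n N a b m\<close> is governed by \<open>m i + \<dots> + m (n - 1)\<close>, not by the full
  \<open>m 0 + \<dots> + m (n - 1)\<close>: for \<open>m = (1, 0, \<dots>, 0)\<close> the polynomial depends on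
  \<open>x 1 + \<dots> + x n\<close> only and is annihilated.
\<close>

definition H_op :: "nat \<Rightarrow> (nat \<Rightarrow> real) \<Rightarrow> nat \<Rightarrow> mfun \<Rightarrow> mfun" where
  "H_op n a i p = (\<lambda>x.
     \<Sum>j=i..n. \<Sum>k\<in>{i..n} - {j}.
       x j * (x k + a k) * (p x - p (x(j := x j - 1, k := x k + 1))))"

definition HT_op :: "nat \<Rightarrow> nat \<Rightarrow> (nat \<Rightarrow> real) \<Rightarrow> real \<Rightarrow> mfun \<Rightarrow> mfun" where
  "HT_op n N a b p = (\<lambda>x. H0_op n N a b p x + H_op n a 1 p x)"


definition weight :: "nat \<Rightarrow> nat \<Rightarrow> (nat \<Rightarrow> real) \<Rightarrow> real \<Rightarrow> (nat \<Rightarrow> nat) \<Rightarrow> real" where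
  "weight n N a b x =
     fact N / ((\<Prod>i=1..n. fact (x i)) * fact (N - (\<Sum>i=1..n. x i)))
     * ((\<Prod>i=1..n. pochhammer (a i) (x i)) * pochhammer b (N - (\<Sum>i=1..n. x i))
        / pochhammer ((\<Sum>i=1..n. a i) + b) N)"

definition inner_prod ::
    "nat \<Rightarrow> nat \<Rightarrow> (nat \<Rightarrow> real) \<Rightarrow> real \<Rightarrow> mfun \<Rightarrow> mfun \<Rightarrow> real" where
  "inner_prod n N a b p q =
     (\<Sum>x\<in>lattice_simplex {1..n} N.
        p (\<lambda>i. real (x i)) * q (\<lambda>i. real (x i)) * weight n N a b x)"


text \<open>
  The sum is cut off at \<open>k = M\<close>. It is used with first upper parameter \<open>-M\<close>, where the series
  terminates; the cut-off matters because a lower parameter may also be a non-positive integer.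
\<close>

definition hyp3F2 ::
    "nat \<Rightarrow> real \<Rightarrow> real \<Rightarrow> real \<Rightarrow> real \<Rightarrow> real \<Rightarrow> real \<Rightarrow> real" where
  "hyp3F2 M a1 a2 a3 b1 b2 z =
     (\<Sum>k=0..M. pochhammer a1 k * pochhammer a2 k * pochhammer a3 k
                / (pochhammer b1 k * pochhammer b2 k * fact k) * z ^ k)"

definition hahn :: "nat \<Rightarrow> real \<Rightarrow> real \<Rightarrow> real \<Rightarrow> real \<Rightarrow> real" where
  "hahn m x a b N = hyp3F2 m (- real m) (real m + a + b - 1) (- x) a (- N) 1"

definition type_two :: "nat \<Rightarrow> real \<Rightarrow> real \<Rightarrow> real \<Rightarrow> real \<Rightarrow> real" where
  "type_two m u v \<alpha> \<gamma> =
     (\<Sum>k=0..m. (-1) ^ k * real (m choose k)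
        * pochhammer (\<gamma> + real k) (m - k) * pochhammer (\<alpha> + real (m - k)) k
        * pochhammer (- u) (m - k) * pochhammer (- v) k)"

definition multi_hahn ::
    "nat \<Rightarrow> nat \<Rightarrow> (nat \<Rightarrow> real) \<Rightarrow> real \<Rightarrow> (nat \<Rightarrow> nat) \<Rightarrow> mfun" where
  "multi_hahn n N a b m = (\<lambda>x.
     (\<Prod>i=1..n-1.
        type_two (m i) (x i) ((\<Sum>j=i+1..n. x j) - (\<Sum>j=i+1..n-1. real (m j)))
          (a i) ((\<Sum>j=i+1..n. a j) + 2 * (\<Sum>j=i+1..n-1. real (m j))))
     * hahn (m 0) ((\<Sum>i=1..n. x i) - (\<Sum>j=1..n-1. real (m j)))
         ((\<Sum>i=1..n. a i) + 2 * (\<Sum>j=1..n-1. real (m j))) b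
         (real N - (\<Sum>j=1..n-1. real (m j))))"

end

theory Submission
  imports Defs
begin

text \<open>
  All operators of the system are of one kind. For a set \<open>J\<close> of sites, the exchange operator moves
  one unit from a site \<open>j \<in> J\<close> to another site \<open>k \<in> J\<close> at rate \<open>x j * (x k + a k)\<close>. The operator
  \<open>H_op n a i\<close> is the one with \<open>J = {i..n}\<close>; and if the redundant coordinate \<open>x 0 = N - |x|\<close> with
  parameter \<open>b\<close> is restored, \<open>HT_op\<close> is the one with \<open>J = {0..n}\<close>, because \<open>H0_op\<close> collects the
  moves that involve the site \<open>0\<close>.

  Eigenvalue equations. With \<open>(R p)(x) = \<Sum>k\<in>J. (x k + a k) * p (x + e k)\<close> and
  \<open>(L p)(x) = \<Sum>k\<in>J. x k * p (x - e k)\<close>, the exchange operator is multiplication by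
  \<open>S * (S + A - 1)\<close> minus the composite \<open>L R\<close>, where \<open>S\<close> and \<open>A\<close> are the sums of \<open>x\<close> and of \<open>a\<close>
  over \<open>J\<close>. So a common solution of \<open>R p = (S + A + s) * p\<close> and \<open>L p = (S - s) * p\<close> is an
  eigenfunction with eigenvalue \<open>s * (s + A - 1)\<close> (\<open>exchange_op_eigen\<close>). A single type two
  polynomial is such a solution in two variables, with \<open>s\<close> equal to its degree
  (\<open>type_two_raising\<close>, \<open>type_two_lowering\<close>), and the shifts by sums of \<open>m\<close> in the arguments and
  parameters are exactly those for which the property passes to the products over \<open>i, \<dots>, n - 1\<close>
  (\<open>type_two_prod_raise_lower\<close>). The factors with smaller index and the Hahn factor only see sums
  that \<open>H_op n a i\<close> preserves. In \<open>HT_op\<close> the two relations reduce the action on the product to an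
  operator in \<open>|x|\<close> alone, and what remains is the classical difference equation of the Hahn
  polynomial.

  Orthogonality. On the points with nonnegative integer entries and \<open>x 0 + \<dots> + x n = N\<close> the weight
  is, up to a constant, a product over the sites, and the exchange rates satisfy detailed balance
  with respect to it. Hence each exchange operator is self-adjoint. The eigenvalues determine all
  sums \<open>m i + \<dots> + m (n - 1)\<close> and hence \<open>m\<close>, so distinct labels give orthogonal polynomials.

  Completeness. At the lattice point \<open>(m 1, \<dots>, m (n - 1), 0)\<close> every factor collapses to its
  single nonvanishing term, so all norms are positive and the family is independent. It lies in
  \<open>poly_space n N\<close> and has as many members as there are monomials of degree at most \<open>N\<close>, so it is a
  basis.
\<close>

section \<open>The type two polynomials\<close>

text \<open>
  The next two lemmas say how the single-variable parts of the lowering and raising operators act on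
  the basis \<open>pochhammer (- u) j\<close>: lowering is diagonal, raising has one extra term of degree one
  less.
\<close>

lemma pochhammer_lowering:
  fixes u :: real
  shows "u * pochhammer (- (u - 1)) j = (u - real j) * pochhammer (- u) j"
proof -
  have "- u * pochhammer (- u + 1) j = (- u + real j) * pochhammer (- u) j"
    by (metis pochhammer_rec pochhammer_rec')
  thus ?thesis by (simp add: algebra_simps)
qed

lemma pochhammer_raising:
  fixes u \<alpha> :: real
  shows "(u + \<alpha>) * pochhammer (- (u + 1)) j
    = (u + \<alpha> + real j) * pochhammer (- u) j
      - real j * (\<alpha> + real j - 1) * pochhammer (- u) (j - 1)"
proof (cases j)
  case (Suc i)
  have 1: "pochhammer (- (u + 1)) j = (- u - 1) * pochhammer (- u) i"
    by (simp add: Suc pochhammer_rec)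
  have 2: "pochhammer (- u) j = (real i - u) * pochhammer (- u) i"
    by (simp add: Suc pochhammer_rec')
  show ?thesis
    unfolding 1 2 by (simp add: Suc algebra_simps)
qed simp

definition type_two_coeff :: "nat \<Rightarrow> real \<Rightarrow> real \<Rightarrow> nat \<Rightarrow> real" where
  "type_two_coeff m \<alpha> \<gamma> k = (-1) ^ k * real (m choose k)
     * pochhammer (\<gamma> + real k) (m - k) * pochhammer (\<alpha> + real (m - k)) k"

lemma type_two_altdef:
  "type_two m u v \<alpha> \<gamma> =
    (\<Sum>k<Suc m. type_two_coeff m \<alpha> \<gamma> k * (pochhammer (- u) (m - k) * pochhammer (- v) k))"
  unfolding type_two_def type_two_coeff_def
  by (rule sum.cong) (auto simp: mult.assoc)

text \<open>
  This recurrence is the cancellation condition for the terms of lower degree that the raising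
  operator produces.
\<close>

lemma type_two_coeff_Suc:
  assumes "k < m"
  shows "type_two_coeff m \<alpha> \<gamma> (Suc k) * (real (Suc k) * (\<gamma> + real k))
    = - type_two_coeff m \<alpha> \<gamma> k * (real (m - k) * (\<alpha> + real (m - k) - 1))"
proof -
  obtain l where l: "m = Suc (k + l)"
    using assms less_iff_Suc_add by auto
  have bin: "real (Suc k) * real (m choose Suc k) = real (m - k) * real (m choose k)"
  proof -
    have "Suc k * (m choose Suc k) = (m - k) * (m choose k)"
      by (metis binomial_absorb_comp binomial_absorption assms mult.commute
          Suc_diff_1 diff_Suc_1 less_imp_Suc_add)
    thus ?thesis by (metis of_nat_mult)
  qed
  have g: "pochhammer (\<gamma> + real k) (m - k) = (\<gamma> + real k) * pochhammer (\<gamma> + real (Suc k)) (m - Suc k)"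
    using l pochhammer_rec[of "\<gamma> + real k" l] by (simp add: add_ac)
  have a: "pochhammer (\<alpha> + real (m - Suc k)) (Suc k)
      = (\<alpha> + real (m - k) - 1) * pochhammer (\<alpha> + real (m - k)) k"
    using l pochhammer_rec[of "\<alpha> + real l" k] by (simp add: add_ac)
  have "type_two_coeff m \<alpha> \<gamma> (Suc k) * (real (Suc k) * (\<gamma> + real k))
     = - ((-1) ^ k) * (real (Suc k) * real (m choose Suc k))
       * ((\<gamma> + real k) * pochhammer (\<gamma> + real (Suc k)) (m - Suc k))
       * pochhammer (\<alpha> + real (m - Suc k)) (Suc k)"
    unfolding type_two_coeff_def by (simp only: power_Suc mult_ac mult_minus_left mult_1_left mult_minus_right)
  also have "\<dots> = - type_two_coeff m \<alpha> \<gamma> k * (real (m - k) * (\<alpha> + real (m - k) - 1))"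
    unfolding bin g[symmetric] a type_two_coeff_def by (simp add: mult_ac)
  finally show ?thesis .
qed

text \<open>
  Every summand satisfies the relation by itself, as \<open>pochhammer (- u) (m - k) * pochhammer (- v) k\<close>
  has total degree \<open>m\<close> and lowering is diagonal on these products.
\<close>

lemma type_two_lowering:
  "u * type_two m (u - 1) v \<alpha> \<gamma> + v * type_two m u (v - 1) \<alpha> \<gamma>
    = (u + v - real m) * type_two m u v \<alpha> \<gamma>"
proof -
  let ?c = "type_two_coeff m \<alpha> \<gamma>"
  have "u * type_two m (u - 1) v \<alpha> \<gamma> + v * type_two m u (v - 1) \<alpha> \<gamma>
    = (\<Sum>k<Suc m. ?c k * ((u * pochhammer (- (u - 1)) (m - k)) * pochhammer (- v) k
          + pochhammer (- u) (m - k) * (v * pochhammer (- (v - 1)) k)))"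
    unfolding type_two_altdef sum_distrib_left sum.distrib[symmetric]
    by (rule sum.cong) (simp_all add: algebra_simps)
  also have "\<dots> = (\<Sum>k<Suc m. (u + v - real m)
      * (?c k * (pochhammer (- u) (m - k) * pochhammer (- v) k)))"
    by (rule sum.cong[OF refl], unfold pochhammer_lowering) (simp add: algebra_simps of_nat_diff)
  finally show ?thesis
    by (simp only: type_two_altdef sum_distrib_left)
qed

text \<open>
  Each summand produces the right-hand side and two terms of total degree \<open>m - 1\<close>. The term from
  \<open>v\<close> of the summand \<open>k + 1\<close> and the term from \<open>u\<close> of the summand \<open>k\<close> are multiples of the same basis
  element and cancel by \<open>type_two_coeff_Suc\<close>.
\<close>

lemma type_two_raising:
  "(u + \<alpha>) * type_two m (u + 1) v \<alpha> \<gamma> + (v + \<gamma>) * type_two m u (v + 1) \<alpha> \<gamma>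
    = (u + v + \<alpha> + \<gamma> + real m) * type_two m u v \<alpha> \<gamma>"
proof -
  let ?c = "type_two_coeff m \<alpha> \<gamma>"
  let ?U = "\<lambda>j. pochhammer (- u) j" and ?V = "\<lambda>k. pochhammer (- v) k"
  have "(u + \<alpha>) * type_two m (u + 1) v \<alpha> \<gamma> + (v + \<gamma>) * type_two m u (v + 1) \<alpha> \<gamma>
    = (\<Sum>k<Suc m. ?c k * (((u + \<alpha>) * pochhammer (- (u + 1)) (m - k)) * ?V k
          + ?U (m - k) * ((v + \<gamma>) * pochhammer (- (v + 1)) k)))"
    unfolding type_two_altdef sum_distrib_left sum.distrib[symmetric]
    by (rule sum.cong) (simp_all add: algebra_simps)
  also have "\<dots> = (\<Sum>k<Suc m. (u + v + \<alpha> + \<gamma> + real m) * (?c k * (?U (m - k) * ?V k))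
      - (?c k * (real (m - k) * (\<alpha> + real (m - k) - 1)) * (?U (m - k - 1) * ?V k)
         + ?c k * (real k * (\<gamma> + real k - 1)) * (?U (m - k) * ?V (k - 1))))"
    by (rule sum.cong[OF refl], unfold pochhammer_raising) (simp add: algebra_simps of_nat_diff)
  also have "\<dots> = (u + v + \<alpha> + \<gamma> + real m) * type_two m u v \<alpha> \<gamma>
      - ((\<Sum>k<Suc m. ?c k * (real (m - k) * (\<alpha> + real (m - k) - 1)) * (?U (m - k - 1) * ?V k))
         + (\<Sum>k<Suc m. ?c k * (real k * (\<gamma> + real k - 1)) * (?U (m - k) * ?V (k - 1))))"
    by (simp only: sum_subtractf sum.distrib type_two_altdef sum_distrib_left)
  also have "(\<Sum>k<Suc m. ?c k * (real k * (\<gamma> + real k - 1)) * (?U (m - k) * ?V (k - 1)))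
      = (\<Sum>k<m. ?c (Suc k) * (real (Suc k) * (\<gamma> + real k)) * (?U (m - k - 1) * ?V k))"
    by (simp only: sum.lessThan_Suc_shift) (simp add: algebra_simps)
  also have "\<dots> = (\<Sum>k<m. - ?c k * (real (m - k) * (\<alpha> + real (m - k) - 1)) * (?U (m - k - 1) * ?V k))"
    by (rule sum.cong[OF refl]) (simp only: type_two_coeff_Suc lessThan_iff)
  finally show ?thesis
    by (simp add: sum_negf)
qed

section \<open>The Hahn polynomials\<close>

definition hahn_coeff :: "nat \<Rightarrow> real \<Rightarrow> real \<Rightarrow> real \<Rightarrow> nat \<Rightarrow> real" where
  "hahn_coeff m a b M k = pochhammer (- real m) k * pochhammer (real m + a + b - 1) k
     / (pochhammer a k * pochhammer (- M) k * fact k)"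

lemma hahn_altdef:
  "hahn m t a b M = (\<Sum>k<Suc m. hahn_coeff m a b M k * pochhammer (- t) k)"
  unfolding hahn_def hyp3F2_def hahn_coeff_def
  by (rule sum.cong) auto

text \<open>
  The bound \<open>m \<le> M\<close> keeps the lower parameter \<open>- M\<close> from producing a zero denominator before the
  series terminates.
\<close>

lemma hahn_coeff_Suc:
  assumes "0 < a" "real m \<le> M" "k < m"
  shows "hahn_coeff m a b M (Suc k) * (real (Suc k) * (M - real k) * (a + real k))
    = (real m - real k) * (real m + real k + a + b - 1) * hahn_coeff m a b M k"
proof -
  have nz: "a + real k \<noteq> 0" "real k - M \<noteq> 0" "real (Suc k) \<noteq> 0"
    using assms by (auto simp del: of_nat_Suc)
  let ?d = "(a + real k) * (real k - M) * real (Suc k)"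
  have "hahn_coeff m a b M (Suc k)
    = hahn_coeff m a b M k * ((real k - real m) * (real m + a + b - 1 + real k) / ?d)"
    by (simp add: hahn_coeff_def pochhammer_rec' mult_ac add_ac)
  moreover have "real (Suc k) * (M - real k) * (a + real k) = - ?d"
    by (simp add: algebra_simps)
  ultimately have "hahn_coeff m a b M (Suc k) * (real (Suc k) * (M - real k) * (a + real k))
    = - (hahn_coeff m a b M k * ((real k - real m) * (real m + a + b - 1 + real k) / ?d * ?d))"
    by (simp only: mult_ac) simp
  also have "\<dots> = - (hahn_coeff m a b M k * ((real k - real m) * (real m + a + b - 1 + real k)))"
    using nz by simp
  finally show ?thesis by (simp add: algebra_simps)
qed

text \<open>
  In the basis \<open>pochhammer (- t) k\<close> the Hahn difference operator is bidiagonal, so its eigenvalue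
  equation becomes a two-term recurrence for the coefficients, namely \<open>hahn_coeff_Suc\<close>.
\<close>

lemma hahn_operator_pochhammer:
  fixes t a b M :: real
  shows "(M - t) * (t + a) * (pochhammer (- t) k - pochhammer (- (t + 1)) k)
       + t * (M - t + b) * (pochhammer (- t) k - pochhammer (- (t - 1)) k)
    = real k * (M - real k + 1) * (a + real k - 1) * pochhammer (- t) (k - 1)
       + real k * (a + b + real k - 1) * pochhammer (- t) k"
proof (cases k)
  case (Suc i)
  let ?p = "pochhammer (- t) i"
  have 1: "pochhammer (- (t + 1)) k = (- t - 1) * ?p"
    by (simp add: Suc pochhammer_rec)
  have 2: "pochhammer (- t) k = (real i - t) * ?p"
    by (simp add: Suc pochhammer_rec')
  have 3: "t * pochhammer (- (t - 1)) k = (t - real k) * ((real i - t) * ?p)"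
    unfolding pochhammer_lowering 2 ..
  have "(M - t) * (t + a) * (pochhammer (- t) k - pochhammer (- (t + 1)) k)
       + t * (M - t + b) * (pochhammer (- t) k - pochhammer (- (t - 1)) k)
     = (M - t) * (t + a) * (pochhammer (- t) k - pochhammer (- (t + 1)) k)
       + (M - t + b) * (t * pochhammer (- t) k - t * pochhammer (- (t - 1)) k)"
    by (simp add: algebra_simps)
  also have "\<dots> = real k * (M - real k + 1) * (a + real k - 1) * pochhammer (- t) (k - 1)
       + real k * (a + b + real k - 1) * pochhammer (- t) k"
    unfolding 1 2 3 by (simp add: Suc algebra_simps)
  finally show ?thesis .
qed simp

lemma hahn_difference_equation:
  fixes t a b M :: real
  assumes "0 < a" "real m \<le> M"
  shows "(M - t) * (t + a) * (hahn m t a b M - hahn m (t + 1) a b M)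
       + t * (M - t + b) * (hahn m t a b M - hahn m (t - 1) a b M)
    = real m * (real m + a + b - 1) * hahn m t a b M"
proof -
  let ?c = "hahn_coeff m a b M" and ?p = "\<lambda>k. pochhammer (- t) k"
  have "(M - t) * (t + a) * (hahn m t a b M - hahn m (t + 1) a b M)
       + t * (M - t + b) * (hahn m t a b M - hahn m (t - 1) a b M)
    = (\<Sum>k<Suc m. ?c k * ((M - t) * (t + a) * (?p k - pochhammer (- (t + 1)) k)
       + t * (M - t + b) * (?p k - pochhammer (- (t - 1)) k)))"
    unfolding hahn_altdef sum_distrib_left sum.distrib[symmetric] sum_subtractf[symmetric]
    by (rule sum.cong) (simp_all add: algebra_simps)
  also have "\<dots> = (\<Sum>k<Suc m. ?c k * (real k * (M - real k + 1) * (a + real k - 1)) * ?p (k - 1))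
      + (\<Sum>k<Suc m. real k * (a + b + real k - 1) * (?c k * ?p k))"
    unfolding hahn_operator_pochhammer sum.distrib[symmetric]
    by (rule sum.cong) (simp_all add: algebra_simps)
  also have "(\<Sum>k<Suc m. ?c k * (real k * (M - real k + 1) * (a + real k - 1)) * ?p (k - 1))
      = (\<Sum>k<m. ?c (Suc k) * (real (Suc k) * (M - real k) * (a + real k)) * ?p k)"
    by (simp only: sum.lessThan_Suc_shift) (simp add: algebra_simps)
  also have "\<dots> = (\<Sum>k<m. (real m - real k) * (real m + real k + a + b - 1) * ?c k * ?p k)"
    by (rule sum.cong[OF refl]) (simp only: hahn_coeff_Suc[OF assms] lessThan_iff)
  also have "\<dots> = (\<Sum>k<Suc m. (real m - real k) * (real m + real k + a + b - 1) * ?c k * ?p k)"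
    by simp
  also have "\<dots> + (\<Sum>k<Suc m. real k * (a + b + real k - 1) * (?c k * ?p k))
      = (\<Sum>k<Suc m. real m * (real m + a + b - 1) * (?c k * ?p k))"
    unfolding sum.distrib[symmetric] by (rule sum.cong) (simp_all add: algebra_simps)
  finally show ?thesis
    by (simp only: hahn_altdef sum_distrib_left)
qed

section \<open>Exchange operators\<close>

definition exchange_op :: "nat set \<Rightarrow> (nat \<Rightarrow> real) \<Rightarrow> mfun \<Rightarrow> mfun" where
  "exchange_op J a p = (\<lambda>x. \<Sum>j\<in>J. \<Sum>k\<in>J - {j}.
     x j * (x k + a k) * (p x - p (x(j := x j - 1, k := x k + 1))))"

definition raise_op :: "nat set \<Rightarrow> (nat \<Rightarrow> real) \<Rightarrow> mfun \<Rightarrow> mfun" where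
  "raise_op J a p = (\<lambda>x. \<Sum>k\<in>J. (x k + a k) * p (x(k := x k + 1)))"

definition lower_op :: "nat set \<Rightarrow> mfun \<Rightarrow> mfun" where
  "lower_op J p = (\<lambda>x. \<Sum>j\<in>J. x j * p (x(j := x j - 1)))"

lemma H_op_eq_exchange_op: "H_op n a i = exchange_op {i..n} a"
  by (simp add: H_op_def exchange_op_def fun_eq_iff)

lemma sum_fun_upd:
  fixes x :: "nat \<Rightarrow> real"
  assumes "finite J" "k \<in> J"
  shows "sum (x(k := c)) J = sum x J - x k + c"
proof -
  have "sum (x(k := c)) (J - {k}) = sum x (J - {k})"
    by (rule sum.cong) auto
  thus ?thesis
    using assms by (simp add: sum.remove[of J k])
qed

lemma sum_fun_upd_notin:
  fixes x :: "nat \<Rightarrow> real"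
  assumes "k \<notin> J"
  shows "sum (x(k := c)) J = sum x J"
  using assms by (intro sum.cong) auto

text \<open>
  The composite \<open>L R\<close> moves a unit from \<open>j\<close> to \<open>k\<close>. The moves with \<open>j \<noteq> k\<close> are those of the exchange
  operator; those with \<open>j = k\<close> return to \<open>x\<close>, and together with the diagonal of the exchange operator
  they add up to a function of the sum over \<open>J\<close>.
\<close>

lemma exchange_op_eq_lower_raise:
  assumes "finite J"
  shows "exchange_op J a p x
    = sum x J * (sum x J + sum a J - 1) * p x - lower_op J (raise_op J a p) x"
proof -
  have lr: "x j * raise_op J a p (x(j := x j - 1))
      = x j * (x j - 1 + a j) * p x
        + (\<Sum>k\<in>J-{j}. x j * (x k + a k) * p (x(j := x j - 1, k := x k + 1)))"
    if "j \<in> J" for j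
    unfolding raise_op_def sum.remove[OF assms that] distrib_left sum_distrib_left
    by (intro arg_cong2[where f = "(+)"] sum.cong) (auto simp: algebra_simps)
  \<comment> \<open>The sites other than \<open>j\<close> supply all of the two sums except for their terms at \<open>j\<close>.\<close>
  have diag: "(\<Sum>k\<in>J-{j}. x j * (x k + a k) * p x) + x j * (x j - 1 + a j) * p x
      = x j * (sum x J + sum a J - 1) * p x" if "j \<in> J" for j
    unfolding sum.remove[OF assms that]
    by (simp add: algebra_simps sum.distrib sum_distrib_left)
  have "exchange_op J a p x + lower_op J (raise_op J a p) x
    = (\<Sum>j\<in>J. (\<Sum>k\<in>J-{j}. x j * (x k + a k) * p x) + x j * (x j - 1 + a j) * p x)"
    unfolding exchange_op_def lower_op_def sum.distrib[symmetric]
    by (rule sum.cong) (simp_all add: lr right_diff_distrib sum_subtractf)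
  also have "\<dots> = sum x J * (sum x J + sum a J - 1) * p x"
    by (simp add: diag sum_distrib_right)
  finally show ?thesis by simp
qed

lemma exchange_op_eigen:
  assumes "finite J"
    and R: "\<And>x. raise_op J a p x = (sum x J + sum a J + s) * p x"
    and L: "\<And>x. lower_op J p x = (sum x J - s) * p x"
  shows "exchange_op J a p x = s * (s + sum a J - 1) * p x"
proof -
  have "lower_op J (raise_op J a p) x
    = (\<Sum>j\<in>J. (sum x J - 1 + sum a J + s) * (x j * p (x(j := x j - 1))))"
    unfolding lower_op_def R
    by (rule sum.cong[OF refl]) (simp add: sum_fun_upd[OF assms(1)] mult_ac del: fun_upd_apply)
  also have "\<dots> = (sum x J - 1 + sum a J + s) * lower_op J p x"
    by (simp add: lower_op_def sum_distrib_left)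
  finally show ?thesis
    unfolding exchange_op_eq_lower_raise[OF assms(1)] L by (simp add: algebra_simps)
qed

text \<open>
  Functions that no move changes behave as constants.
\<close>

lemma exchange_op_mult_invariant:
  assumes "\<And>x j k. j \<in> J \<Longrightarrow> k \<in> J \<Longrightarrow> j \<noteq> k \<Longrightarrow> g (x(j := x j - 1, k := x k + 1)) = g x"
  shows "exchange_op J a (\<lambda>x. g x * p x) x = g x * exchange_op J a p x"
  unfolding exchange_op_def sum_distrib_left
  by (intro sum.cong refl) (simp add: assms right_diff_distrib mult_ac del: fun_upd_apply)

section \<open>Products of type two polynomials\<close>

text \<open>
  Factor and tail product involve the variables \<open>x i, \<dots>, x n\<close> only, which is what makes a downward
  induction on \<open>i\<close> possible.
\<close>

definition type_two_factor ::
    "nat \<Rightarrow> (nat \<Rightarrow> real) \<Rightarrow> (nat \<Rightarrow> nat) \<Rightarrow> nat \<Rightarrow> mfun" where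
  "type_two_factor n a m i = (\<lambda>x.
     type_two (m i) (x i) ((\<Sum>j=i+1..n. x j) - (\<Sum>j=i+1..n-1. real (m j)))
       (a i) ((\<Sum>j=i+1..n. a j) + 2 * (\<Sum>j=i+1..n-1. real (m j))))"

definition type_two_prod ::
    "nat \<Rightarrow> (nat \<Rightarrow> real) \<Rightarrow> (nat \<Rightarrow> nat) \<Rightarrow> nat \<Rightarrow> mfun" where
  "type_two_prod n a m i = (\<lambda>x. \<Prod>l=i..n-1. type_two_factor n a m l x)"

lemma type_two_factor_cong:
  "(\<And>j. j \<in> {i..n} \<Longrightarrow> x j = y j) \<Longrightarrow> i \<le> n \<Longrightarrow>
    type_two_factor n a m i x = type_two_factor n a m i y"
  unfolding type_two_factor_def
  by (intro arg_cong3[where f = "\<lambda>u v w. type_two (m i) u v (a i) w"]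
      arg_cong2[where f = "(-)"] sum.cong) auto

lemma type_two_prod_cong:
  assumes "\<And>j. j \<in> {i..n} \<Longrightarrow> x j = y j"
  shows "type_two_prod n a m i x = type_two_prod n a m i y"
  unfolding type_two_prod_def
  using assms by (intro prod.cong refl type_two_factor_cong) auto

lemma type_two_prod_rec:
  assumes "i < n"
  shows "type_two_prod n a m i x = type_two_factor n a m i x * type_two_prod n a m (Suc i) x"
proof -
  have "{i..n-1} = insert i {Suc i..n-1}" using assms by auto
  thus ?thesis by (simp add: type_two_prod_def)
qed

text \<open>
  Downward induction on \<open>i\<close>. With \<open>y\<close> the sum of the variables beyond \<open>i\<close> and \<open>s\<close> the sum of the
  labels beyond \<open>i\<close>, the induction hypothesis makes the later sites act like a single site with
  \<open>v = y - s\<close>: lowering contributes the factor \<open>v\<close>, raising the factor \<open>v + \<gamma>\<close> with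
  \<open>\<gamma> = a (i + 1) + \<dots> + a n + 2 * s\<close>. These are the arguments of the factor with index \<open>i\<close>, so the
  two-variable relations apply.
\<close>

lemma type_two_prod_raise_lower:
  assumes "i \<le> n" "0 < n"
  shows "(\<forall>x. raise_op {i..n} a (type_two_prod n a m i) x
        = (sum x {i..n} + sum a {i..n} + (\<Sum>j=i..n-1. real (m j))) * type_two_prod n a m i x)
    \<and> (\<forall>x. lower_op {i..n} (type_two_prod n a m i) x
        = (sum x {i..n} - (\<Sum>j=i..n-1. real (m j))) * type_two_prod n a m i x)"
  using assms(1)
proof (induction i rule: inc_induct)
  case base
  show ?case
    using assms(2) by (simp add: type_two_prod_def raise_op_def lower_op_def)
next
  case (step i)
  let ?s = "\<Sum>j=Suc i..n-1. real (m j)"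
  let ?Q = "type_two_prod n a m (Suc i)"
  let ?\<gamma> = "sum a {Suc i..n} + 2 * ?s"
  define T where "T = (\<lambda>u y. type_two (m i) u (y - ?s) (a i) ?\<gamma>)"
  have ins: "{i..n} = insert i {Suc i..n}" and ins': "{i..n-1} = insert i {Suc i..n-1}"
    using step.hyps by auto
  have rec: "type_two_prod n a m i x = T (x i) (sum x {Suc i..n}) * ?Q x" for x
    using step.hyps by (simp add: type_two_prod_rec type_two_factor_def T_def)
  \<comment> \<open>A change at \<open>i\<close> reaches only the first argument of the new factor, a change at a later site only its second argument and the old product.\<close>
  have fixed: "?Q (x(i := c)) = ?Q x" for x c
    by (rule type_two_prod_cong) auto
  have upd: "type_two_prod n a m i (x(k := c)) = T (x i) (sum x {Suc i..n} - x k + c) * ?Q (x(k := c))"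
    if "k \<in> {Suc i..n}" for x k c
    using that by (simp add: rec sum_fun_upd del: fun_upd_apply) simp
  have upd_i: "type_two_prod n a m i (x(i := c)) = T c (sum x {Suc i..n}) * ?Q x" for x c
    by (simp add: rec sum_fun_upd_notin fixed)
  have R: "raise_op {i..n} a (type_two_prod n a m i) x
      = (sum x {i..n} + sum a {i..n} + (\<Sum>j=i..n-1. real (m j))) * type_two_prod n a m i x" for x
  proof -
    let ?y = "sum x {Suc i..n}"
    have "raise_op {i..n} a (type_two_prod n a m i) x
      = (x i + a i) * T (x i + 1) ?y * ?Q x + T (x i) (?y + 1) * raise_op {Suc i..n} a ?Q x"
      unfolding raise_op_def ins by (simp add: upd_i upd sum_distrib_left mult_ac)
    also have "raise_op {Suc i..n} a ?Q x = (?y - ?s + ?\<gamma>) * ?Q x"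
      using step.IH by (simp add: algebra_simps)
    also have "(x i + a i) * T (x i + 1) ?y * ?Q x + T (x i) (?y + 1) * ((?y - ?s + ?\<gamma>) * ?Q x)
      = ((x i + a i) * type_two (m i) (x i + 1) (?y - ?s) (a i) ?\<gamma>
         + (?y - ?s + ?\<gamma>) * type_two (m i) (x i) (?y - ?s + 1) (a i) ?\<gamma>) * ?Q x"
      by (simp add: T_def algebra_simps)
    also have "\<dots> = (x i + (?y - ?s) + a i + ?\<gamma> + real (m i)) * type_two_prod n a m i x"
      unfolding type_two_raising rec T_def by (simp add: mult_ac)
    finally show ?thesis
      unfolding ins ins' by (simp add: algebra_simps)
  qed
  have L: "lower_op {i..n} (type_two_prod n a m i) x
      = (sum x {i..n} - (\<Sum>j=i..n-1. real (m j))) * type_two_prod n a m i x" for x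
  proof -
    let ?y = "sum x {Suc i..n}"
    have "lower_op {i..n} (type_two_prod n a m i) x
      = x i * T (x i - 1) ?y * ?Q x + T (x i) (?y - 1) * lower_op {Suc i..n} ?Q x"
      unfolding lower_op_def ins by (simp add: upd_i upd sum_distrib_left mult_ac)
    also have "lower_op {Suc i..n} ?Q x = (?y - ?s) * ?Q x"
      using step.IH by simp
    also have "x i * T (x i - 1) ?y * ?Q x + T (x i) (?y - 1) * ((?y - ?s) * ?Q x)
      = (x i * type_two (m i) (x i - 1) (?y - ?s) (a i) ?\<gamma>
         + (?y - ?s) * type_two (m i) (x i) (?y - ?s - 1) (a i) ?\<gamma>) * ?Q x"
      by (simp add: T_def algebra_simps)
    also have "\<dots> = (x i + (?y - ?s) - real (m i)) * type_two_prod n a m i x"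
      unfolding type_two_lowering rec T_def by (simp add: mult_ac)
    finally show ?thesis
      unfolding ins ins' by (simp add: algebra_simps)
  qed
  show ?case using R L by blast
qed

section \<open>Eigenvalue equations\<close>

lemma multi_hahn_altdef:
  "multi_hahn n N a b m x = hahn (m 0) (sum x {1..n} - (\<Sum>j=1..n-1. real (m j)))
      (sum a {1..n} + 2 * (\<Sum>j=1..n-1. real (m j))) b (real N - (\<Sum>j=1..n-1. real (m j)))
    * type_two_prod n a m 1 x"
  by (simp add: multi_hahn_def type_two_prod_def type_two_factor_def)

lemma multi_hahn_cong:
  assumes "\<And>j. j \<in> {1..n} \<Longrightarrow> x j = y j"
  shows "multi_hahn n N a b m x = multi_hahn n N a b m y"
  using sum.cong[OF refl assms] type_two_prod_cong[of 1 n x y a m] assms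
  by (simp add: multi_hahn_altdef)

lemma H_op_multi_hahn:
  assumes "i \<in> {1..n-1}"
  shows "H_op n a i (multi_hahn n N a b m) x
    = (\<Sum>j=i..n-1. real (m j)) * ((\<Sum>j=i..n-1. real (m j)) + (\<Sum>j=i..n. a j) - 1)
      * multi_hahn n N a b m x"
proof -
  define h where "h = (\<lambda>y. hahn (m 0) (y - (\<Sum>j=1..n-1. real (m j)))
      (sum a {1..n} + 2 * (\<Sum>j=1..n-1. real (m j))) b (real N - (\<Sum>j=1..n-1. real (m j))))"
  \<comment> \<open>\<open>g\<close> collects what the moves within \<open>{i..n}\<close> leave unchanged.\<close>
  define g where "g = (\<lambda>x. h (sum x {1..n}) * (\<Prod>l=1..<i. type_two_factor n a m l x))"
  have "{1..n-1} = {1..<i} \<union> {i..n-1}"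
    using assms by auto
  hence split: "multi_hahn n N a b m = (\<lambda>x. g x * type_two_prod n a m i x)"
    unfolding multi_hahn_altdef type_two_prod_def g_def h_def fun_eq_iff
    by (simp add: prod.union_disjoint ivl_disj_int mult.assoc)
  have sum_inv: "sum (x(j := x j - 1, k := x k + 1)) S = sum x S"
    if "finite S" "j \<in> S" "k \<in> S" "j \<noteq> k" for x :: "nat \<Rightarrow> real" and j k S
    using that by (simp add: sum_fun_upd del: fun_upd_apply) simp
  have inv: "g (x(j := x j - 1, k := x k + 1)) = g x"
    if "j \<in> {i..n}" "k \<in> {i..n}" "j \<noteq> k" for x j k
  proof -
    have "type_two_factor n a m l (x(j := x j - 1, k := x k + 1)) = type_two_factor n a m l x"
      if "l \<in> {1..<i}" for l
      unfolding type_two_factor_def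
      using \<open>j \<in> _\<close> \<open>k \<in> _\<close> \<open>j \<noteq> k\<close> that by (subst sum_inv) auto
    moreover have "sum (x(j := x j - 1, k := x k + 1)) {1..n} = sum x {1..n}"
      using that assms by (intro sum_inv) auto
    ultimately show ?thesis by (simp add: g_def)
  qed
  have "exchange_op {i..n} a (type_two_prod n a m i) x
    = (\<Sum>j=i..n-1. real (m j)) * ((\<Sum>j=i..n-1. real (m j)) + sum a {i..n} - 1)
      * type_two_prod n a m i x"
    using type_two_prod_raise_lower[of i n a m] assms by (intro exchange_op_eigen) auto
  thus ?thesis
    unfolding H_op_eq_exchange_op split
    by (subst exchange_op_mult_invariant[where g = g, OF inv]) auto
qed

text \<open>
  Inserting the raising and lowering relations of the product into \<open>H0_op\<close> leaves a difference
  operator in \<open>|x|\<close>. In the shifted variable \<open>t = |x| - \<sigma>\<close>, with \<open>\<sigma> = m 1 + \<dots> + m (n - 1)\<close>, it is the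
  Hahn operator with parameters \<open>|a| + 2 * \<sigma>\<close>, \<open>b\<close> and \<open>N - \<sigma>\<close> plus the constant \<open>\<sigma> * b\<close>, and
  \<open>H_op n a 1\<close> adds its eigenvalue \<open>\<sigma> * (\<sigma> + |a| - 1)\<close>.
\<close>

lemma HT_op_multi_hahn:
  assumes n: "2 \<le> n" and N: "(\<Sum>j<n. m j) \<le> N" and a: "\<forall>i\<in>{1..n}. 0 < a i"
  shows "HT_op n N a b (multi_hahn n N a b m) x
    = (\<Sum>j<n. real (m j)) * ((\<Sum>j<n. real (m j)) + sum a {1..n} + b - 1)
      * multi_hahn n N a b m x"
proof -
  let ?\<sigma> = "\<Sum>j=1..n-1. real (m j)" and ?A = "sum a {1..n}" and ?Q = "type_two_prod n a m 1"
  let ?S = "sum x {1..n}" and ?P = "multi_hahn n N a b m"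
  define h where "h = (\<lambda>t. hahn (m 0) t (?A + 2 * ?\<sigma>) b (real N - ?\<sigma>))"
  define t where "t = ?S - ?\<sigma>"
  have "{..<n} = insert 0 {1..n-1}" using n by auto
  hence total: "(\<Sum>j<n. real (m j)) = real (m 0) + ?\<sigma>" by simp
  have P: "?P y = h (sum y {1..n} - ?\<sigma>) * ?Q y" for y
    by (simp add: multi_hahn_altdef h_def)
  have R: "(\<Sum>j=1..n. (x j + a j) * ?P (x(j := x j + 1))) = (?S + ?A + ?\<sigma>) * h (t + 1) * ?Q x"
  proof -
    have "(\<Sum>j=1..n. (x j + a j) * ?P (x(j := x j + 1)))
        = (\<Sum>j=1..n. h (t + 1) * ((x j + a j) * ?Q (x(j := x j + 1))))"
      by (rule sum.cong) (simp_all add: P sum_fun_upd t_def algebra_simps del: fun_upd_apply)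
    also have "\<dots> = h (t + 1) * raise_op {1..n} a ?Q x"
      by (simp add: raise_op_def sum_distrib_left)
    finally show ?thesis
      using type_two_prod_raise_lower[of 1 n a m] n by simp
  qed
  have L: "(\<Sum>j=1..n. x j * ?P (x(j := x j - 1))) = (?S - ?\<sigma>) * h (t - 1) * ?Q x"
  proof -
    have "(\<Sum>j=1..n. x j * ?P (x(j := x j - 1)))
        = (\<Sum>j=1..n. h (t - 1) * (x j * ?Q (x(j := x j - 1))))"
      by (rule sum.cong) (simp_all add: P sum_fun_upd t_def algebra_simps del: fun_upd_apply)
    also have "\<dots> = h (t - 1) * lower_op {1..n} ?Q x"
      by (simp add: lower_op_def sum_distrib_left)
    finally show ?thesis
      using type_two_prod_raise_lower[of 1 n a m] n by simp
  qed
  have H0: "H0_op n N a b ?P x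
    = (real N - ?S) * ((?S + ?A) * ?P x - (\<Sum>j=1..n. (x j + a j) * ?P (x(j := x j + 1))))
      + (real N - ?S + b) * (?S * ?P x - (\<Sum>j=1..n. x j * ?P (x(j := x j - 1))))"
  proof -
    have 1: "(\<Sum>j=1..n. (real N - ?S) * (x j + a j) * (?P x - ?P (x(j := x j + 1))))
      = (real N - ?S) * ((?S + ?A) * ?P x - (\<Sum>j=1..n. (x j + a j) * ?P (x(j := x j + 1))))"
      by (simp add: sum.distrib[symmetric] sum_distrib_left sum_distrib_right
          sum_subtractf[symmetric] right_diff_distrib mult.assoc)
    have 2: "(\<Sum>j=1..n. x j * (real N - ?S + b) * (?P x - ?P (x(j := x j - 1))))
      = (real N - ?S + b) * (?S * ?P x - (\<Sum>j=1..n. x j * ?P (x(j := x j - 1))))"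
      unfolding sum_distrib_left sum_distrib_right sum_subtractf[symmetric]
      by (rule sum.cong) (simp_all add: algebra_simps)
    show ?thesis unfolding H0_op_def 1 2 ..
  qed
  have H1: "H_op n a 1 ?P x = ?\<sigma> * (?\<sigma> + ?A - 1) * ?P x"
    using n by (intro H_op_multi_hahn) auto
  have "0 < ?A + 2 * ?\<sigma>"
    using a n by (intro add_pos_nonneg sum_pos) (auto intro: sum_nonneg)
  moreover have "real (m 0) \<le> real N - ?\<sigma>"
    using N total by (metis le_diff_eq of_nat_le_iff of_nat_sum)
  ultimately have D: "((real N - ?\<sigma>) - t) * (t + (?A + 2 * ?\<sigma>)) * (h t - h (t + 1))
       + t * ((real N - ?\<sigma>) - t + b) * (h t - h (t - 1))
    = real (m 0) * (real (m 0) + (?A + 2 * ?\<sigma>) + b - 1) * h t"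
    unfolding h_def by (rule hahn_difference_equation)
  have S: "?S = t + ?\<sigma>" by (simp add: t_def)
  have "HT_op n N a b ?P x = (((real N - ?\<sigma>) - t) * (t + (?A + 2 * ?\<sigma>)) * (h t - h (t + 1))
       + t * ((real N - ?\<sigma>) - t + b) * (h t - h (t - 1))
       + ?\<sigma> * (?A + b + ?\<sigma> - 1) * h t) * ?Q x"
    unfolding HT_op_def H0 H1 R L unfolding P t_def[symmetric] S by (simp add: algebra_simps)
  also have "\<dots> = (\<Sum>j<n. real (m j)) * ((\<Sum>j<n. real (m j)) + ?A + b - 1) * ?P x"
    unfolding D total unfolding P t_def[symmetric] by (simp add: algebra_simps)
  finally show ?thesis .
qed

section \<open>Orthogonality\<close>

lemma finite_lattice_simplex:
  assumes "finite I"
  shows "finite (lattice_simplex I N)"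
proof (rule finite_subset)
  show "lattice_simplex I N \<subseteq> {x. \<forall>i. (i \<in> I \<longrightarrow> x i \<in> {..N}) \<and> (i \<notin> I \<longrightarrow> x i = 0)}"
    unfolding lattice_simplex_def using assms
    by (auto intro: order_trans[OF member_le_sum])
  show "finite {x. \<forall>i. (i \<in> I \<longrightarrow> x i \<in> {..N}) \<and> (i \<notin> I \<longrightarrow> x i = (0::nat))}"
    using assms by (intro finite_set_of_finite_funs) auto
qed

text \<open>
  The layer is the simplex with its redundant coordinate restored; unlike the simplex it treats all
  sites alike.
\<close>

definition layer :: "nat set \<Rightarrow> nat \<Rightarrow> (nat \<Rightarrow> nat) set" where
  "layer I N = {z. (\<forall>i. i \<notin> I \<longrightarrow> z i = 0) \<and> sum z I = N}"

definition site_prod :: "nat set \<Rightarrow> (nat \<Rightarrow> real) \<Rightarrow> (nat \<Rightarrow> nat) \<Rightarrow> real" where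
  "site_prod I c z = (\<Prod>i\<in>I. pochhammer (c i) (z i) / fact (z i))"

lemma finite_layer:
  assumes "finite I"
  shows "finite (layer I N)"
  by (rule finite_subset[OF _ finite_lattice_simplex[OF assms, of N]])
     (auto simp: layer_def lattice_simplex_def)

lemma layer_move:
  assumes "finite I" "z \<in> layer I N" "j \<in> I" "k \<in> I" "j \<noteq> k" "0 < z j"
  shows "z(j := z j - 1, k := z k + 1) \<in> layer I N"
proof -
  have I: "I = insert j (insert k (I - {j, k}))" using assms by auto
  have "sum (z(j := z j - 1, k := z k + 1)) (I - {j, k}) = sum z (I - {j, k})"
    by (rule sum.cong) auto
  moreover have "sum f I = f j + (f k + sum f (I - {j, k}))" for f :: "nat \<Rightarrow> nat"
    using assms by (subst I) simp
  ultimately show ?thesis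
    using assms by (auto simp: layer_def)
qed

text \<open>
  Only the sites \<open>j\<close> and \<open>k\<close> matter, and there it is the one-site identity
  \<open>w (s + 1) * (s + 1) = w s * (s + c)\<close> for \<open>w s = pochhammer c s / fact s\<close>, used once at each site.
\<close>

lemma detailed_balance:
  assumes "finite I" "j \<in> I" "k \<in> I" "j \<noteq> k" "0 < z j"
  shows "site_prod I c z * (real (z j) * (real (z k) + c k))
    = site_prod I c (z(j := z j - 1, k := z k + 1)) * (real (z k + 1) * (real (z j - 1) + c j))"
proof -
  obtain t where t: "z j = Suc t" using assms by (cases "z j") auto
  have I: "I = insert j (insert k (I - {j, k}))" using assms by auto
  define w :: "real \<Rightarrow> nat \<Rightarrow> real" where "w = (\<lambda>d s. pochhammer d s / fact s)"
  define r where "r = (\<Prod>i\<in>I - {j, k}. w (c i) (z i))"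
  have r: "(\<Prod>i\<in>I - {j, k}. w (c i) ((z(j := z j - 1, k := z k + 1)) i)) = r"
    unfolding r_def by (rule prod.cong) auto
  have split: "prod f I = f j * (f k * prod f (I - {j, k}))" for f :: "nat \<Rightarrow> real"
    using assms by (subst I) simp
  have site: "w d (Suc s) * real (Suc s) = w d s * (real s + d)" for d s
    by (simp add: w_def pochhammer_rec' add_ac del: of_nat_Suc)
  have prod: "site_prod I c y = (\<Prod>i\<in>I. w (c i) (y i))" for y
    by (simp add: site_prod_def w_def)
  have "site_prod I c z * (real (z j) * (real (z k) + c k))
      = (w (c j) (Suc t) * real (Suc t)) * (w (c k) (z k) * (real (z k) + c k)) * r"
    unfolding prod split r_def[symmetric] t by (simp only: mult_ac)
  also have "\<dots> = (w (c j) t * (real t + c j)) * (w (c k) (Suc (z k)) * real (Suc (z k))) * r"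
    by (simp only: site)
  also have "\<dots> = site_prod I c (z(j := z j - 1, k := z k + 1)) * (real (z k + 1) * (real (z j - 1) + c j))"
    using assms(4) unfolding prod split r by (simp add: t del: of_nat_Suc)
  finally show ?thesis .
qed

abbreviation (input) of_nat_fun :: "(nat \<Rightarrow> nat) \<Rightarrow> nat \<Rightarrow> real" where
  "of_nat_fun z \<equiv> (\<lambda>i. real (z i))"

text \<open>
  The diagonal part is multiplication by a function. The rest is a sum over moves, and reversing each
  move exchanges the roles of \<open>p\<close> and \<open>q\<close> and, by detailed balance, keeps the weighted rate. Moves
  out of an empty site have rate zero, which is why only those with \<open>0 < z j\<close> are kept: for them
  truncated subtraction on the lattice agrees with subtraction of reals.
\<close>

lemma exchange_op_selfadjoint:
  assumes I: "finite I" and J: "J \<subseteq> I"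
  shows "(\<Sum>z\<in>layer I N. exchange_op J c p (of_nat_fun z) * q (of_nat_fun z) * site_prod I c z)
    = (\<Sum>z\<in>layer I N. p (of_nat_fun z) * exchange_op J c q (of_nat_fun z) * site_prod I c z)"
proof -
  let ?L = "layer I N" and ?w = "site_prod I c"
  let ?v = "\<lambda>(z, j, k). z(j := z j - 1, k := z k + (1::nat))"
  let ?rev = "\<lambda>(z, j, k). (z(j := z j - 1, k := z k + (1::nat)), k, j)"
  let ?r = "\<lambda>(z, j, k). ?w z * (real (z j) * (real (z k) + c k))"
  define E where "E = {(z, j, k). z \<in> ?L \<and> j \<in> J \<and> k \<in> J \<and> j \<noteq> k \<and> 0 < z j}"
  define B where "B = (\<lambda>f g :: mfun. \<Sum>e\<in>E. ?r e * f (of_nat_fun (?v e)) * g (of_nat_fun (fst e)))"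
  have finJ: "finite J" using I J finite_subset by blast
  \<comment> \<open>\<open>E\<close> is the set of moves, \<open>?v\<close> the target of a move, \<open>?r\<close> its weighted rate and \<open>?rev\<close> the reversed move.\<close>
  have B_sym: "B f g = B g f" for f g
    unfolding B_def
  proof (rule sum.reindex_bij_witness[where i = "?rev" and j = "?rev"])
    fix e assume e: "e \<in> E"
    obtain z j k where [simp]: "e = (z, j, k)" by (cases e)
    have *: "z \<in> ?L" "j \<in> J" "k \<in> J" "j \<noteq> k" "0 < z j"
      using e by (auto simp: E_def)
    show "?rev (?rev e) = e" using * by (auto simp: fun_eq_iff)
    show "?rev (?rev e) = e" by fact
    show "?rev e \<in> E" and "?rev e \<in> E"
      using * J layer_move[OF I, of z N j k] by (auto simp: E_def)
    have "?r (?rev e) = ?r e"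
      using * J detailed_balance[OF I, of j k z c] by (auto simp: subset_iff)
    moreover have "?v (?rev e) = fst e" "fst (?rev e) = ?v e"
      using * by (auto simp: fun_eq_iff)
    ultimately show "?r (?rev e) * g (of_nat_fun (?v (?rev e))) * f (of_nat_fun (fst (?rev e)))
        = ?r e * f (of_nat_fun (?v e)) * g (of_nat_fun (fst e))"
      by (simp only: mult_ac)
  qed
  have expand: "(\<Sum>z\<in>?L. exchange_op J c f (of_nat_fun z) * g (of_nat_fun z) * ?w z)
    = (\<Sum>z\<in>?L. (\<Sum>j\<in>J. \<Sum>k\<in>J-{j}. real (z j) * (real (z k) + c k))
        * f (of_nat_fun z) * g (of_nat_fun z) * ?w z) - B f g" for f g
  proof -
    let ?m = "\<lambda>z j k. (of_nat_fun z)(j := real (z j) - 1, k := real (z k) + 1)"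
    let ?h = "\<lambda>(z, j, k). ?w z * (real (z j) * (real (z k) + c k)) * f (?m z j k) * g (of_nat_fun z)"
    have "(\<Sum>z\<in>?L. \<Sum>j\<in>J. \<Sum>k\<in>J-{j}. ?h (z, j, k))
        = (\<Sum>e\<in>Sigma ?L (\<lambda>z. Sigma J (\<lambda>j. J - {j})). ?h e)"
      using I finJ by (simp add: sum.Sigma finite_layer)
    also have "\<dots> = (\<Sum>e\<in>E. ?h e)"
      using I finJ by (intro sum.mono_neutral_right) (auto simp: E_def finite_layer)
    also have "\<dots> = B f g"
      unfolding B_def
    proof (rule sum.cong[OF refl])
      fix e assume "e \<in> E"
      then obtain z j k where e: "e = (z, j, k)" "0 < z j" "j \<noteq> k"
        by (auto simp: E_def)
      hence "?m z j k = of_nat_fun (?v e)"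
        by (auto simp: fun_eq_iff of_nat_diff)
      thus "?h e = ?r e * f (of_nat_fun (?v e)) * g (of_nat_fun (fst e))"
        by (simp add: e)
    qed
    finally have B: "B f g = (\<Sum>z\<in>?L. \<Sum>j\<in>J. \<Sum>k\<in>J-{j}. ?h (z, j, k))" ..
    show ?thesis
      unfolding B sum_subtractf[symmetric] exchange_op_def sum_distrib_right
      by (intro sum.cong refl) (simp add: algebra_simps)
  qed
  have "(\<Sum>z\<in>?L. exchange_op J c p (of_nat_fun z) * q (of_nat_fun z) * ?w z)
    = (\<Sum>z\<in>?L. exchange_op J c q (of_nat_fun z) * p (of_nat_fun z) * ?w z)"
    unfolding expand B_sym[of p q] by (simp add: mult_ac)
  thus ?thesis by (simp add: mult_ac)
qed

lemma exchange_op_eigenfunctions_orthogonal: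
  assumes "finite I" "J \<subseteq> I" "\<mu> \<noteq> \<nu>"
    and "\<And>z. z \<in> layer I N \<Longrightarrow> exchange_op J c p (of_nat_fun z) = \<mu> * p (of_nat_fun z)"
    and "\<And>z. z \<in> layer I N \<Longrightarrow> exchange_op J c q (of_nat_fun z) = \<nu> * q (of_nat_fun z)"
  shows "(\<Sum>z\<in>layer I N. p (of_nat_fun z) * q (of_nat_fun z) * site_prod I c z) = 0"
proof -
  let ?S = "\<Sum>z\<in>layer I N. p (of_nat_fun z) * q (of_nat_fun z) * site_prod I c z"
  have "\<mu> * ?S = (\<Sum>z\<in>layer I N. exchange_op J c p (of_nat_fun z) * q (of_nat_fun z) * site_prod I c z)"
    by (simp add: assms(4) sum_distrib_left mult_ac)
  also have "\<dots> = (\<Sum>z\<in>layer I N. p (of_nat_fun z) * exchange_op J c q (of_nat_fun z) * site_prod I c z)"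
    by (rule exchange_op_selfadjoint[OF assms(1,2)])
  also have "\<dots> = \<nu> * ?S"
    by (simp add: assms(5) sum_distrib_left mult_ac)
  finally show ?thesis using assms(3) by simp
qed

lemma HT_op_eq_exchange_op:
  assumes p: "\<And>x t. p (x(0 := t)) = p x" and x0: "x 0 = real N - sum x {1..n}"
  shows "exchange_op {0..n} (a(0 := b)) p x = HT_op n N a b p x"
proof -
  have p0: "p (x(0 := t, k := u)) = p (x(k := u))" if "k \<in> {1..n}" for k t u
    using that by (subst fun_upd_twist) (auto simp only: p atLeastAtMost_iff)
  define F where "F = (\<lambda>j. \<Sum>k\<in>{0..n} - {j}. x j * (x k + (a(0 := b)) k)
    * (p x - p (x(j := x j - 1, k := x k + 1))))"
  have F0: "F 0 = (\<Sum>k=1..n. x 0 * (x k + a k) * (p x - p (x(k := x k + 1))))"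
    unfolding F_def by (rule sum.cong) (auto simp only: p0 fun_upd_other atLeastAtMost_iff)
  have F: "F j = x j * (x 0 + b) * (p x - p (x(j := x j - 1)))
      + (\<Sum>k\<in>{1..n} - {j}. x j * (x k + a k) * (p x - p (x(j := x j - 1, k := x k + 1))))"
    if "j \<in> {1..n}" for j
  proof -
    have "{0..n} - {j} = insert 0 ({1..n} - {j})" using that by auto
    hence "F j = x j * (x 0 + b) * (p x - p (x(j := x j - 1, 0 := x 0 + 1)))
      + (\<Sum>k\<in>{1..n} - {j}. x j * (x k + (a(0 := b)) k)
          * (p x - p (x(j := x j - 1, k := x k + 1))))"
      unfolding F_def by simp
    moreover have "(a(0 := b)) k = a k" if "k \<in> {1..n} - {j}" for k
      using that by auto
    ultimately show ?thesis by (simp only: p cong: sum.cong)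
  qed
  have "exchange_op {0..n} (a(0 := b)) p x = (\<Sum>j\<in>insert 0 {1..n}. F j)"
    unfolding exchange_op_def F_def by (rule sum.cong) auto
  also have "\<dots> = F 0 + (\<Sum>j=1..n. F j)"
    by simp
  also have "\<dots> = HT_op n N a b p x"
    unfolding HT_op_def H0_op_def H_op_def F0 by (simp only: F sum.distrib x0 add.assoc cong: sum.cong)
  finally show ?thesis .
qed

text \<open>
  Restoring the coordinate \<open>x 0 = N - |x|\<close> identifies the simplex with a layer and makes the weight a
  product over all sites, with \<open>b\<close> as the parameter of the site \<open>0\<close>.
\<close>

lemma inner_prod_eq_layer_sum:
  assumes p: "\<And>x t. p (x(0 := t)) = p x" and q: "\<And>x t. q (x(0 := t)) = q x"
  shows "inner_prod n N a b p q = fact N / pochhammer (sum a {1..n} + b) N *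
    (\<Sum>z\<in>layer {0..n} N. p (of_nat_fun z) * q (of_nat_fun z) * site_prod {0..n} (a(0 := b)) z)"
proof -
  have ins: "{0..n} = insert 0 {1..n}" by auto
  have upd: "sum (x(0 := t)) {1..n} = sum x {1..n}" for x :: "nat \<Rightarrow> nat" and t
    by (rule sum.cong) auto
  let ?up = "\<lambda>x :: nat \<Rightarrow> nat. x(0 := N - sum x {1..n})"
  let ?C = "fact N / pochhammer (sum a {1..n} + b) N"
  show ?thesis
    unfolding inner_prod_def sum_distrib_left
  proof (rule sum.reindex_bij_witness[where i = "\<lambda>z. z(0 := 0)" and j = ?up])
    fix x assume x: "x \<in> lattice_simplex {1..n} N"
    hence x0: "x 0 = 0" and le: "sum x {1..n} \<le> N" by (auto simp: lattice_simplex_def)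
    show "(?up x)(0 := 0) = x" using x0 by (auto simp: fun_eq_iff)
    have "sum (?up x) {0..n} = (N - sum x {1..n}) + sum (?up x) {1..n}"
      unfolding ins by (subst sum.insert) auto
    hence "sum (?up x) {0..n} = N"
      unfolding upd using le by simp
    thus "?up x \<in> layer {0..n} N"
      using x by (auto simp: layer_def lattice_simplex_def)
    have cast: "of_nat_fun (?up x) = (of_nat_fun x)(0 := real (N - sum x {1..n}))"
      by (auto simp: fun_eq_iff)
    have "(\<Prod>i=1..n. pochhammer ((a(0 := b)) i) ((?up x) i) / fact ((?up x) i))
        = (\<Prod>i=1..n. pochhammer (a i) (x i) / fact (x i))"
      by (rule prod.cong) auto
    hence site: "site_prod {0..n} (a(0 := b)) (?up x)
        = pochhammer b (N - sum x {1..n}) / fact (N - sum x {1..n})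
          * (\<Prod>i=1..n. pochhammer (a i) (x i) / fact (x i))"
      unfolding site_prod_def ins by (subst prod.insert) auto
    have weight: "?C * site_prod {0..n} (a(0 := b)) (?up x) = weight n N a b x"
      unfolding site weight_def prod_dividef by (simp add: mult_ac)
    have p_eq: "p (of_nat_fun (?up x)) = p (of_nat_fun x)"
      unfolding cast by (rule p)
    have q_eq: "q (of_nat_fun (?up x)) = q (of_nat_fun x)"
      unfolding cast by (rule q)
    show "?C * (p (of_nat_fun (?up x)) * q (of_nat_fun (?up x))
        * site_prod {0..n} (a(0 := b)) (?up x))
       = p (of_nat_fun x) * q (of_nat_fun x) * weight n N a b x"
      unfolding p_eq q_eq weight[symmetric] by (rule mult.left_commute)
  next
    fix z assume z: "z \<in> layer {0..n} N"
    hence N: "z 0 + sum z {1..n} = N" unfolding ins layer_def by simp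
    show "z(0 := 0) \<in> lattice_simplex {1..n} N"
      using z N upd[of z 0] by (auto simp: layer_def lattice_simplex_def)
    have "(z(0 := 0))(0 := N - sum z {1..n}) = z"
      using N by (auto simp: fun_eq_iff)
    thus "?up (z(0 := 0)) = z"
      unfolding upd .
  qed
qed

text \<open>
  The difference of the two sides factors as \<open>(s - t) * (s + t + A - 1)\<close>, and the second factor is
  positive unless \<open>s = t = 0\<close>.
\<close>

lemma eigenvalue_inj:
  fixes A :: real and s t :: nat
  assumes "0 < A" "real s * (real s + A - 1) = real t * (real t + A - 1)"
  shows "s = t"
proof (rule ccontr)
  assume "s \<noteq> t"
  have "(real s - real t) * (real s + real t + A - 1) = 0"
    using assms(2) by (simp add: algebra_simps)
  moreover have "1 \<le> s + t"
    using \<open>s \<noteq> t\<close> by linarith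
  hence "1 \<le> real s + real t"
    by (metis of_nat_1 of_nat_add of_nat_le_iff)
  hence "real s + real t + A - 1 \<noteq> 0"
    using assms(1) by linarith
  ultimately show False
    using \<open>s \<noteq> t\<close> by simp
qed

lemma eq_if_tail_sums_eq:
  fixes m m' :: "nat \<Rightarrow> nat"
  assumes "\<And>i. i < n \<Longrightarrow> sum m {i..n-1} = sum m' {i..n-1}" "i < n"
  shows "m i = m' i"
proof -
  have "sum m {Suc i..n-1} = sum m' {Suc i..n-1}"
    using assms(1)[of "Suc i"] by (cases "Suc i < n") auto
  moreover have "{i..n-1} = insert i {Suc i..n-1}" using assms(2) by auto
  ultimately show ?thesis using assms(1)[OF assms(2)] by simp
qed

text \<open>
  Distinct labels differ in some sum \<open>m i + \<dots> + m (n - 1)\<close>, and this sum is detected by the eigenvalue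
  of the exchange operator on \<open>{i..n}\<close>, which is \<open>HT_op\<close> for \<open>i = 0\<close> and \<open>H_op n a i\<close> otherwise.
\<close>

lemma multi_hahn_orthogonal:
  assumes n: "2 \<le> n" and a: "\<forall>i\<in>{1..n}. 0 < a i" and b: "0 < b"
    and m: "m \<in> lattice_simplex {..<n} N" and m': "m' \<in> lattice_simplex {..<n} N" and "m \<noteq> m'"
  shows "inner_prod n N a b (multi_hahn n N a b m) (multi_hahn n N a b m') = 0"
proof -
  let ?P = "multi_hahn n N a b"
  have "\<exists>i<n. sum m {i..n-1} \<noteq> sum m' {i..n-1}"
  proof (rule ccontr)
    assume *: "\<not> (\<exists>i<n. sum m {i..n-1} \<noteq> sum m' {i..n-1})"
    have "m i = m' i" if "i < n" for i
      by (rule eq_if_tail_sums_eq[of n m m' i]) (use that * in auto)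
    moreover have "m i = m' i" if "\<not> i < n" for i
      using that m m' by (simp add: lattice_simplex_def)
    ultimately show False using \<open>m \<noteq> m'\<close> by blast
  qed
  then obtain i where i: "i < n" "sum m {i..n-1} \<noteq> sum m' {i..n-1}" by blast
  have P0: "?P m (x(0 := t)) = ?P m x" for m x t
    by (rule multi_hahn_cong) auto
  let ?A = "sum (a(0 := b)) {i..n}"
  have pos: "0 < ?A"
    using i a b by (intro sum_pos) auto
  have eig: "exchange_op {i..n} (a(0 := b)) (?P m) (of_nat_fun z)
      = real (sum m {i..n-1}) * (real (sum m {i..n-1}) + ?A - 1) * ?P m (of_nat_fun z)"
    if m: "m \<in> lattice_simplex {..<n} N" and z: "z \<in> layer {0..n} N" for m z
  proof (cases "i = 0")
    case True
    have ins: "{0..n} = insert 0 {1..n}" by auto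
    have "z 0 + sum z {1..n} = N" using z unfolding ins layer_def by simp
    hence "real (z 0) + real (sum z {1..n}) = real N" by (metis of_nat_add)
    hence x0: "real (z 0) = real N - sum (of_nat_fun z) {1..n}" by simp
    have A: "?A = sum a {1..n} + b"
      unfolding True ins by simp
    have dom: "{..<n} = {0..n-1}" using n by auto
    have "(\<Sum>j<n. m j) \<le> N" using m by (simp add: lattice_simplex_def)
    from HT_op_multi_hahn[OF n this a, of b "of_nat_fun z"] show ?thesis
      unfolding True A[unfolded True] HT_op_eq_exchange_op[OF P0 x0] dom of_nat_sum add.assoc .
  next
    case False
    have "exchange_op {i..n} (a(0 := b)) (?P m) (of_nat_fun z) = H_op n a i (?P m) (of_nat_fun z)"
      unfolding H_op_eq_exchange_op exchange_op_def using False by (intro sum.cong refl) auto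
    moreover have "?A = sum a {i..n}" using False by (intro sum.cong) auto
    moreover have "i \<in> {1..n-1}" using False i(1) by auto
    ultimately show ?thesis
      by (simp only: H_op_multi_hahn of_nat_sum)
  qed
  have "(\<Sum>z\<in>layer {0..n} N. ?P m (of_nat_fun z) * ?P m' (of_nat_fun z)
      * site_prod {0..n} (a(0 := b)) z) = 0"
  proof (rule exchange_op_eigenfunctions_orthogonal[OF _ _ _ eig[OF m] eig[OF m']])
    show "real (sum m {i..n-1}) * (real (sum m {i..n-1}) + ?A - 1)
        \<noteq> real (sum m' {i..n-1}) * (real (sum m' {i..n-1}) + ?A - 1)"
      using i(2) eigenvalue_inj[OF pos] by blast
  qed auto
  thus ?thesis
    unfolding inner_prod_eq_layer_sum[OF P0 P0] by (simp only: mult_zero_right)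
qed

section \<open>Positive norms\<close>

lemma type_two_at_corner:
  "type_two m (real m) 0 \<alpha> \<gamma> = pochhammer \<gamma> m * pochhammer (- real m) m"
proof -
  have "type_two m (real m) 0 \<alpha> \<gamma> = (\<Sum>k=0..m. if k = 0 then pochhammer \<gamma> m * pochhammer (- real m) m else 0)"
    unfolding type_two_def by (rule sum.cong) (auto simp: pochhammer_0_left)
  thus ?thesis by simp
qed

lemma hahn_at_zero: "hahn m 0 a b M = 1"
proof -
  have "hahn m 0 a b M = (\<Sum>k=0..m. if k = 0 then 1 else 0)"
    unfolding hahn_def hyp3F2_def by (rule sum.cong) (auto simp: pochhammer_0_left)
  thus ?thesis by simp
qed

text \<open>
  It suffices that the polynomial does not vanish at one lattice point. At
  \<open>x = (m 1, \<dots>, m (n - 1), 0)\<close> the shifted sums that serve as second arguments of the type two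
  factors and as argument of the Hahn factor are all zero.
\<close>

lemma multi_hahn_norm_pos:
  assumes n: "2 \<le> n" and a: "\<forall>i\<in>{1..n}. 0 < a i" and b: "0 < b"
    and m: "m \<in> lattice_simplex {..<n} N"
  shows "0 < inner_prod n N a b (multi_hahn n N a b m) (multi_hahn n N a b m)"
proof -
  define x where "x = (\<lambda>i. if i \<in> {1..n-1} then m i else 0)"
  have tail: "sum x {i..n} = sum m {i..n-1}" if "1 \<le> i" "i \<le> n" for i
    unfolding x_def using that by (intro sum.mono_neutral_cong_right) auto
  have tail': "(\<Sum>j=i..n. real (x j)) = (\<Sum>j=i..n-1. real (m j))" if "1 \<le> i" "i \<le> n" for i
    using tail[OF that] by (simp flip: of_nat_sum)
  have "{..<n} = insert 0 {1..n-1}" using n by auto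
  hence "sum m {1..n-1} \<le> N" using m by (simp add: lattice_simplex_def)
  hence x: "x \<in> lattice_simplex {1..n} N"
    using n tail[of 1] by (auto simp: lattice_simplex_def x_def)
  have "type_two_factor n a m i (of_nat_fun x) \<noteq> 0" if "i \<in> {1..n-1}" for i
  proof -
    have "0 < sum a {i+1..n} + 2 * (\<Sum>j=i+1..n-1. real (m j))"
      using that a by (intro add_pos_nonneg sum_pos) (auto intro: sum_nonneg)
    hence "pochhammer (sum a {i+1..n} + 2 * (\<Sum>j=i+1..n-1. real (m j))) (m i) \<noteq> 0"
      using pochhammer_pos by (metis less_irrefl)
    moreover have "pochhammer (- real (m i)) (m i) \<noteq> 0"
      by (auto simp: pochhammer_eq_0_iff)
    moreover have xi: "x i = m i" using that by (simp add: x_def)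
    have "(\<Sum>j=i+1..n. real (x j)) - (\<Sum>j=i+1..n-1. real (m j)) = 0"
      using that by (subst tail') auto
    ultimately show ?thesis
      unfolding type_two_factor_def xi by (simp only: type_two_at_corner mult_eq_0_iff not_False_eq_True de_Morgan_disj simp_thms)
  qed
  hence nz: "multi_hahn n N a b m (of_nat_fun x) \<noteq> 0"
    using n tail'[of 1] by (simp add: multi_hahn_altdef type_two_prod_def hahn_at_zero)
  have w: "0 < weight n N a b y" for y
    unfolding weight_def using a b n
    by (intro mult_pos_pos divide_pos_pos prod_pos pochhammer_pos add_pos_pos sum_pos) auto
  show ?thesis
    unfolding inner_prod_def
  proof (rule sum_pos2[OF _ x])
    show "0 < multi_hahn n N a b m (of_nat_fun x) * multi_hahn n N a b m (of_nat_fun x) * weight n N a b x"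
      using nz w[of x] by (simp add: zero_less_mult_iff linorder_neq_iff disj_commute)
    show "0 \<le> multi_hahn n N a b m (of_nat_fun y) * multi_hahn n N a b m (of_nat_fun y) * weight n N a b y" for y
      by (intro mult_nonneg_nonneg zero_le_square less_imp_le[OF w])
  qed (simp add: finite_lattice_simplex)
qed

section \<open>Polynomials of bounded degree\<close>

lemma poly_spaceI:
  assumes "\<And>x. p x = (\<Sum>\<alpha>\<in>lattice_simplex {1..n} d. c \<alpha> * (\<Prod>i=1..n. x i ^ \<alpha> i))"
  shows "p \<in> poly_space n d"
  unfolding poly_space_def mem_Collect_eq by (intro exI[where x = c] ext assms)

lemma poly_spaceE:
  assumes "p \<in> poly_space n d"
  obtains c where "\<And>x. p x = (\<Sum>\<alpha>\<in>lattice_simplex {1..n} d. c \<alpha> * (\<Prod>i=1..n. x i ^ \<alpha> i))"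
proof -
  obtain c where "p = (\<lambda>x. \<Sum>\<alpha>\<in>lattice_simplex {1..n} d. c \<alpha> * (\<Prod>i=1..n. x i ^ \<alpha> i))"
    using assms unfolding poly_space_def mem_Collect_eq by (elim exE)
  thus ?thesis by (intro that[of c]) (simp only:)
qed

lemma poly_space_monomial:
  assumes "\<alpha> \<in> lattice_simplex {1..n} d"
  shows "(\<lambda>x. \<Prod>i=1..n. x i ^ \<alpha> i) \<in> poly_space n d"
proof (rule poly_spaceI)
  fix x :: "nat \<Rightarrow> real"
  have "(\<Sum>\<beta>\<in>lattice_simplex {1..n} d. (if \<beta> = \<alpha> then 1 else 0) * (\<Prod>i=1..n. x i ^ \<beta> i))
      = (\<Sum>\<beta>\<in>lattice_simplex {1..n} d. if \<beta> = \<alpha> then \<Prod>i=1..n. x i ^ \<beta> i else 0)"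
    by (rule sum.cong) auto
  thus "(\<Prod>i=1..n. x i ^ \<alpha> i)
      = (\<Sum>\<beta>\<in>lattice_simplex {1..n} d. (if \<beta> = \<alpha> then 1 else 0) * (\<Prod>i=1..n. x i ^ \<beta> i))"
    using assms by (simp only: sum.delta finite_lattice_simplex finite_atLeastAtMost if_True)
qed

lemma poly_space_scale:
  assumes "p \<in> poly_space n d"
  shows "(\<lambda>x. c * p x) \<in> poly_space n d"
proof -
  obtain e where e: "\<And>x. p x = (\<Sum>\<alpha>\<in>lattice_simplex {1..n} d. e \<alpha> * (\<Prod>i=1..n. x i ^ \<alpha> i))"
    using assms by (rule poly_spaceE) blast
  show ?thesis
    by (rule poly_spaceI[where c = "\<lambda>\<alpha>. c * e \<alpha>"]) (simp only: e sum_distrib_left mult.assoc)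
qed

lemma poly_space_add:
  assumes "p \<in> poly_space n d" "q \<in> poly_space n d"
  shows "(\<lambda>x. p x + q x) \<in> poly_space n d"
proof -
  obtain e where e: "\<And>x. p x = (\<Sum>\<alpha>\<in>lattice_simplex {1..n} d. e \<alpha> * (\<Prod>i=1..n. x i ^ \<alpha> i))"
    using assms(1) by (rule poly_spaceE) blast
  obtain f where f: "\<And>x. q x = (\<Sum>\<alpha>\<in>lattice_simplex {1..n} d. f \<alpha> * (\<Prod>i=1..n. x i ^ \<alpha> i))"
    using assms(2) by (rule poly_spaceE) blast
  show ?thesis
    by (rule poly_spaceI[where c = "\<lambda>\<alpha>. e \<alpha> + f \<alpha>"]) (simp only: e f sum.distrib distrib_right)
qed

lemma poly_space_const: "(\<lambda>x. c) \<in> poly_space n d"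
proof -
  have "(\<lambda>i. 0) \<in> lattice_simplex {1..n} d"
    by (simp add: lattice_simplex_def)
  hence "(\<lambda>x. c * (\<Prod>i=1..n. x i ^ 0)) \<in> poly_space n d"
    by (intro poly_space_scale poly_space_monomial)
  thus ?thesis by simp
qed

lemma poly_space_sum:
  assumes "\<And>s. s \<in> S \<Longrightarrow> f s \<in> poly_space n d"
  shows "(\<lambda>x. \<Sum>s\<in>S. f s x) \<in> poly_space n d"
  using assms
proof (induction S rule: infinite_finite_induct)
  case (insert s S)
  have "(\<lambda>x. f s x + (\<Sum>t\<in>S. f t x)) \<in> poly_space n d"
    using insert by (intro poly_space_add) auto
  thus ?case using insert.hyps by simp
qed (simp_all add: poly_space_const)

text \<open>
  Products are treated by expanding one factor at a time, so that it is enough to multiply by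
  monomials.
\<close>

lemma poly_space_expand:
  assumes "p \<in> poly_space n d"
    and "\<And>\<alpha>. \<alpha> \<in> lattice_simplex {1..n} d \<Longrightarrow> (\<lambda>x. (\<Prod>i=1..n. x i ^ \<alpha> i) * q x) \<in> poly_space n e"
  shows "(\<lambda>x. p x * q x) \<in> poly_space n e"
proof -
  obtain c where c: "\<And>x. p x = (\<Sum>\<alpha>\<in>lattice_simplex {1..n} d. c \<alpha> * (\<Prod>i=1..n. x i ^ \<alpha> i))"
    using assms(1) by (rule poly_spaceE) blast
  have "(\<lambda>x. p x * q x) = (\<lambda>x. \<Sum>\<alpha>\<in>lattice_simplex {1..n} d. c \<alpha> * ((\<Prod>i=1..n. x i ^ \<alpha> i) * q x))"
    by (simp only: c sum_distrib_right mult.assoc)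
  also have "\<dots> \<in> poly_space n e"
    by (intro poly_space_sum poly_space_scale assms(2))
  finally show ?thesis .
qed

lemma poly_space_mult:
  assumes p: "p \<in> poly_space n d" and q: "q \<in> poly_space n e"
  shows "(\<lambda>x. p x * q x) \<in> poly_space n (d + e)"
proof (rule poly_space_expand[OF p])
  fix \<alpha> assume \<alpha>: "\<alpha> \<in> lattice_simplex {1..n} d"
  have "(\<lambda>x. q x * (\<Prod>i=1..n. x i ^ \<alpha> i)) \<in> poly_space n (d + e)"
  proof (rule poly_space_expand[OF q])
    fix \<beta> assume \<beta>: "\<beta> \<in> lattice_simplex {1..n} e"
    have "(\<lambda>i. \<alpha> i + \<beta> i) \<in> lattice_simplex {1..n} (d + e)"
      using \<alpha> \<beta> by (simp add: lattice_simplex_def sum.distrib)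
    from poly_space_monomial[OF this]
    show "(\<lambda>x. (\<Prod>i=1..n. x i ^ \<beta> i) * (\<Prod>i=1..n. x i ^ \<alpha> i)) \<in> poly_space n (d + e)"
      by (simp add: power_add prod.distrib mult.commute)
  qed
  thus "(\<lambda>x. (\<Prod>i=1..n. x i ^ \<alpha> i) * q x) \<in> poly_space n (d + e)"
    by (simp add: mult.commute)
qed

lemma poly_space_mono:
  assumes "p \<in> poly_space n d" "d \<le> e"
  shows "p \<in> poly_space n e"
proof -
  have "(\<lambda>x. p x * 1) \<in> poly_space n (d + (e - d))"
    by (intro poly_space_mult poly_space_const assms)
  thus ?thesis using assms(2) by simp
qed

lemma poly_space_var:
  assumes "i \<in> {1..n}"
  shows "(\<lambda>x. x i) \<in> poly_space n 1"
proof -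
  have "(\<lambda>j. if j = i then 1 else 0) \<in> lattice_simplex {1..n} 1"
    using assms by (auto simp: lattice_simplex_def)
  hence "(\<lambda>x. \<Prod>j=1..n. x j ^ (if j = i then 1 else 0)) \<in> poly_space n 1"
    by (rule poly_space_monomial)
  moreover have "(\<Prod>j=1..n. x j ^ (if j = i then 1 else 0)) = x i" for x :: "nat \<Rightarrow> real"
  proof -
    have "(\<Prod>j=1..n. x j ^ (if j = i then 1 else 0)) = (\<Prod>j=1..n. if j = i then x j else 1)"
      by (rule prod.cong) auto
    thus ?thesis using assms by (simp only: prod.delta finite_atLeastAtMost if_True)
  qed
  ultimately show ?thesis by (simp only:)
qed

lemma poly_space_pochhammer:
  assumes "p \<in> poly_space n 1"
  shows "(\<lambda>x. pochhammer (p x) k) \<in> poly_space n k"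
proof (induction k)
  case 0
  show ?case by (simp add: poly_space_const)
next
  case (Suc k)
  have "(\<lambda>x. pochhammer (p x) k * (p x + real k)) \<in> poly_space n (k + 1)"
    by (intro poly_space_mult Suc poly_space_add assms poly_space_const)
  thus ?case by (simp add: pochhammer_Suc)
qed

lemma poly_space_prod:
  assumes "\<And>s. s \<in> S \<Longrightarrow> f s \<in> poly_space n (d s)"
  shows "(\<lambda>x. \<Prod>s\<in>S. f s x) \<in> poly_space n (\<Sum>s\<in>S. d s)"
  using assms
proof (induction S rule: infinite_finite_induct)
  case (insert s S)
  have "(\<lambda>x. f s x * (\<Prod>t\<in>S. f t x)) \<in> poly_space n (d s + (\<Sum>t\<in>S. d t))"
    using insert by (intro poly_space_mult) auto
  thus ?case using insert.hyps by simp
qed (simp_all add: poly_space_const)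

lemma poly_space_type_two:
  assumes "p \<in> poly_space n 1" "q \<in> poly_space n 1"
  shows "(\<lambda>x. type_two m (p x) (q x) \<alpha> \<gamma>) \<in> poly_space n m"
  unfolding type_two_def
proof (rule poly_space_sum)
  fix k assume k: "k \<in> {0..m}"
  have neg: "(\<lambda>x. - p x) \<in> poly_space n 1" "(\<lambda>x. - q x) \<in> poly_space n 1"
    using poly_space_scale[OF assms(1), of "-1"] poly_space_scale[OF assms(2), of "-1"] by simp_all
  let ?c = "(-1) ^ k * real (m choose k) * pochhammer (\<gamma> + real k) (m - k)
    * pochhammer (\<alpha> + real (m - k)) k"
  have "(\<lambda>x. ?c * (pochhammer (- p x) (m - k) * pochhammer (- q x) k)) \<in> poly_space n ((m - k) + k)"
    by (intro poly_space_scale poly_space_mult poly_space_pochhammer neg)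
  thus "(\<lambda>x. ?c * pochhammer (- p x) (m - k) * pochhammer (- q x) k) \<in> poly_space n m"
    using k by (simp add: mult.assoc)
qed

lemma poly_space_hahn:
  assumes "p \<in> poly_space n 1"
  shows "(\<lambda>x. hahn m (p x) a b M) \<in> poly_space n m"
  unfolding hahn_altdef
proof (rule poly_space_sum)
  fix k assume k: "k \<in> {..<Suc m}"
  have neg: "(\<lambda>x. - p x) \<in> poly_space n 1"
    using poly_space_scale[OF assms, of "-1"] by simp
  have "(\<lambda>x. hahn_coeff m a b M k * pochhammer (- p x) k) \<in> poly_space n k"
    by (intro poly_space_scale poly_space_pochhammer neg)
  thus "(\<lambda>x. hahn_coeff m a b M k * pochhammer (- p x) k) \<in> poly_space n m"
    by (rule poly_space_mono) (use k in simp)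
qed

lemma multi_hahn_in_poly_space:
  assumes n: "2 \<le> n" and m: "m \<in> lattice_simplex {..<n} N"
  shows "multi_hahn n N a b m \<in> poly_space n N"
proof -
  have affine: "(\<lambda>x. (\<Sum>j=i..n. x j) - c) \<in> poly_space n 1" if "1 \<le> i" for i c
  proof -
    have "(\<lambda>x. (\<Sum>j=i..n. x j) + (- c)) \<in> poly_space n 1"
      using that by (intro poly_space_add poly_space_sum poly_space_var poly_space_const) auto
    thus ?thesis by simp
  qed
  have "multi_hahn n N a b m \<in> poly_space n ((\<Sum>i=1..n-1. m i) + m 0)"
    unfolding multi_hahn_def
    by (intro poly_space_mult poly_space_prod poly_space_type_two poly_space_hahn affine poly_space_var)
       auto
  moreover have "{..<n} = insert 0 {1..n-1}" using n by auto
  hence "(\<Sum>i=1..n-1. m i) + m 0 \<le> N"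
    using m by (simp add: lattice_simplex_def)
  ultimately show ?thesis by (rule poly_space_mono)
qed

section \<open>Completeness\<close>

text \<open>
  Otherwise an element outside the span could be added to \<open>B\<close>, giving an independent set larger than
  the spanning set \<open>T\<close>.
\<close>

lemma independent_spans_if_card_ge:
  assumes T: "finite T" and B: "fun_space.independent B" "B \<subseteq> fun_space.span T"
    and card: "card T \<le> card B"
  shows "fun_space.span T \<subseteq> fun_space.span B"
proof
  fix p assume p: "p \<in> fun_space.span T"
  show "p \<in> fun_space.span B"
  proof (rule ccontr)
    assume np: "p \<notin> fun_space.span B"
    have "finite B" using fun_space.independent_span_bound[OF T B] by blast
    moreover have "fun_space.independent (insert p B)"
      using np B(1) by (rule fun_space.independent_insertI)
    hence "card (insert p B) \<le> card T"
      using fun_space.independent_span_bound[OF T] B(2) p by blast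
    moreover have "p \<notin> B" using np fun_space.span_base by blast
    ultimately show False using card by simp
  qed
qed

lemma poly_space_subspace: "fun_space.subspace (poly_space n d)"
proof (rule fun_space.subspaceI)
  show "0 \<in> poly_space n d"
    using poly_space_const[of 0] by (simp add: zero_fun_def)
  show "p + q \<in> poly_space n d" if "p \<in> poly_space n d" "q \<in> poly_space n d" for p q
    using poly_space_add[OF that] by (simp add: plus_fun_def)
  show "fscale c p \<in> poly_space n d" if "p \<in> poly_space n d" for c p
    using poly_space_scale[OF that] by (simp add: fscale_def)
qed

lemma sum_fun_apply: "(\<Sum>s\<in>S. f s) x = (\<Sum>s\<in>S. (f s x :: real))"
  by (induction S rule: infinite_finite_induct) auto

lemma poly_space_subset_span:
  "poly_space n d \<subseteq> fun_space.span ((\<lambda>\<alpha> x. \<Prod>i=1..n. x i ^ \<alpha> i) ` lattice_simplex {1..n} d)"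
proof
  fix p assume "p \<in> poly_space n d"
  then obtain c where p: "\<And>x. p x = (\<Sum>\<alpha>\<in>lattice_simplex {1..n} d. c \<alpha> * (\<Prod>i=1..n. x i ^ \<alpha> i))"
    by (rule poly_spaceE) blast
  have "p = (\<Sum>\<alpha>\<in>lattice_simplex {1..n} d. fscale (c \<alpha>) (\<lambda>x. \<Prod>i=1..n. x i ^ \<alpha> i))"
    by (rule ext) (simp only: p sum_fun_apply fscale_def)
  also have "\<dots> \<in> fun_space.span ((\<lambda>\<alpha> x. \<Prod>i=1..n. x i ^ \<alpha> i) ` lattice_simplex {1..n} d)"
    by (intro fun_space.span_sum fun_space.span_scale fun_space.span_base imageI)
  finally show "p \<in> fun_space.span ((\<lambda>\<alpha> x. \<Prod>i=1..n. x i ^ \<alpha> i) ` lattice_simplex {1..n} d)" .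
qed

text \<open>
  The variables are numbered from \<open>1\<close> and the labels from \<open>0\<close>; shifting the index by one is
  injective because the entry at \<open>0\<close> of an exponent vector is fixed.
\<close>

lemma card_lattice_simplex_le: "card (lattice_simplex {1..n} N) \<le> card (lattice_simplex {..<n} N)"
proof (rule card_inj_on_le)
  show "inj_on (\<lambda>x. x \<circ> Suc) (lattice_simplex {1..n} N)"
  proof (rule inj_onI)
    fix x y assume x: "x \<in> lattice_simplex {1..n} N" and y: "y \<in> lattice_simplex {1..n} N"
      and "x \<circ> Suc = y \<circ> Suc"
    hence "x (Suc i) = y (Suc i)" for i by (simp add: fun_eq_iff)
    moreover have "x 0 = y 0" using x y by (simp add: lattice_simplex_def)
    ultimately show "x = y" by (metis ext not0_implies_Suc)
  qed
  show "(\<lambda>x. x \<circ> Suc) ` lattice_simplex {1..n} N \<subseteq> lattice_simplex {..<n} N"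
    by (auto simp: lattice_simplex_def sum.atLeast1_atMost_eq)
qed (simp add: finite_lattice_simplex)

lemma inner_prod_sum_left:
  "inner_prod n N a b (\<Sum>s\<in>S. fscale (c s) (f s)) q = (\<Sum>s\<in>S. c s * inner_prod n N a b (f s) q)"
  unfolding inner_prod_def sum_fun_apply fscale_def sum_distrib_right sum_distrib_left
  by (subst sum.swap) (simp add: mult.assoc)

text \<open>
  Pairing a linear relation with one member isolates the coefficient of that member, multiplied by
  a nonzero number.
\<close>

lemma orthogonal_family_independent:
  assumes fin: "finite M"
    and orth: "\<And>m m'. m \<in> M \<Longrightarrow> m' \<in> M \<Longrightarrow> m \<noteq> m' \<Longrightarrow> inner_prod n N a b (f m) (f m') = 0"
    and pos: "\<And>m. m \<in> M \<Longrightarrow> inner_prod n N a b (f m) (f m) \<noteq> 0"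
  shows "inj_on f M" and "fun_space.independent (f ` M)"
proof -
  show inj: "inj_on f M"
    using orth pos by (metis inj_onI)
  show "fun_space.independent (f ` M)"
    unfolding fun_space.dependent_finite[OF finite_imageI[OF fin]]
  proof (intro notI, elim exE conjE bexE)
    fix u v assume u: "(\<Sum>v\<in>f ` M. fscale (u v) v) = 0" and v: "v \<in> f ` M" "u v \<noteq> 0"
    obtain m where m: "m \<in> M" "v = f m" using v by blast
    have "0 = inner_prod n N a b (\<Sum>v\<in>f ` M. fscale (u v) v) (f m)"
      unfolding u by (simp add: inner_prod_def)
    also have "\<dots> = (\<Sum>m'\<in>M. u (f m') * inner_prod n N a b (f m') (f m))"
      unfolding inner_prod_sum_left by (simp add: sum.reindex[OF inj])
    also have "\<dots> = u (f m) * inner_prod n N a b (f m) (f m)"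
      using fin m orth by (subst sum.remove[of M m]) (auto intro!: sum.neutral)
    finally show False using pos m v by simp
  qed
qed

theorem theorem4p1:
  fixes N n :: nat and a :: "nat \<Rightarrow> real" and b :: real
  assumes "2 \<le> n" and "n < N"
    and "\<forall>i\<in>{1..n}. 0 < a i" and "0 < b"
  shows
    "inj_on (multi_hahn n N a b) (lattice_simplex {..<n} N)
     \<and> fun_space.independent (multi_hahn n N a b ` lattice_simplex {..<n} N)
     \<and> fun_space.span (multi_hahn n N a b ` lattice_simplex {..<n} N) = poly_space n N
     \<and> (\<forall>m\<in>lattice_simplex {..<n} N. \<forall>x.
          multi_hahn n N a b m x =
            (\<Prod>i=1..n-1. \<Sum>k=0..m i.
               (-1) ^ k * real (m i choose k)
               * pochhammer ((\<Sum>j=i+1..n. a j) + 2 * (\<Sum>j=i+1..n-1. real (m j)) + real k) (m i - k)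
               * pochhammer (a i + real (m i) - real k) k
               * pochhammer (- x i) (m i - k)
               * pochhammer (- (\<Sum>j=i+1..n. x j) + (\<Sum>j=i+1..n-1. real (m j))) k)
            * hyp3F2 (m 0)
                (- real (m 0))
                (real (m 0) + 2 * (\<Sum>j=1..n-1. real (m j)) + (\<Sum>i=1..n. a i) + b - 1)
                (- (\<Sum>i=1..n. x i) + (\<Sum>j=1..n-1. real (m j)))
                ((\<Sum>i=1..n. a i) + 2 * (\<Sum>j=1..n-1. real (m j)))
                (- real N + (\<Sum>j=1..n-1. real (m j)))
                1)
     \<and> (\<forall>m\<in>lattice_simplex {..<n} N.
          HT_op n N a b (multi_hahn n N a b m) =
            fscale ((\<Sum>j<n. real (m j)) * ((\<Sum>j<n. real (m j)) + (\<Sum>i=1..n. a i) + b - 1))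
              (multi_hahn n N a b m))
     \<and> (\<forall>m\<in>lattice_simplex {..<n} N. \<forall>i\<in>{1..n-1}.
          H_op n a i (multi_hahn n N a b m) =
            fscale ((\<Sum>j=i..n-1. real (m j)) * ((\<Sum>j=i..n-1. real (m j)) + (\<Sum>j=i..n. a j) - 1))
              (multi_hahn n N a b m))
     \<and> (\<forall>m\<in>lattice_simplex {..<n} N. \<forall>m'\<in>lattice_simplex {..<n} N.
          m \<noteq> m' \<longrightarrow>
          inner_prod n N a b (multi_hahn n N a b m) (multi_hahn n N a b m') = 0)"
proof -
  let ?P = "multi_hahn n N a b" and ?M = "lattice_simplex {..<n} N"
  let ?mon = "\<lambda>\<alpha> x. \<Prod>i=1..n. x i ^ \<alpha> i :: real"
  let ?T = "?mon ` lattice_simplex {1..n} N"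
  have orth: "inner_prod n N a b (?P m) (?P m') = 0" if "m \<in> ?M" "m' \<in> ?M" "m \<noteq> m'" for m m'
    by (rule multi_hahn_orthogonal[OF assms(1,3,4) that])
  have norm: "inner_prod n N a b (?P m) (?P m) \<noteq> 0" if "m \<in> ?M" for m
    using multi_hahn_norm_pos[OF assms(1,3,4) that] by simp
  have finM: "finite ?M" by (simp add: finite_lattice_simplex)
  have inj: "inj_on ?P ?M"
    by (rule orthogonal_family_independent(1)[OF finM orth norm])
  have indep: "fun_space.independent (?P ` ?M)"
    by (rule orthogonal_family_independent(2)[OF finM orth norm])
  have sub: "?P ` ?M \<subseteq> poly_space n N"
    using multi_hahn_in_poly_space[OF assms(1)] by blast
  have "card ?T \<le> card (lattice_simplex {1..n} N)"
    by (intro card_image_le finite_lattice_simplex) auto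
  also have "\<dots> \<le> card (?P ` ?M)"
    using card_lattice_simplex_le[of n N] by (simp add: card_image[OF inj])
  finally have "fun_space.span ?T \<subseteq> fun_space.span (?P ` ?M)"
    using indep sub poly_space_subset_span[of n N]
    by (intro independent_spans_if_card_ge) (auto simp: finite_lattice_simplex)
  hence span: "fun_space.span (?P ` ?M) = poly_space n N"
    using poly_space_subset_span[of n N] fun_space.span_minimal[OF sub poly_space_subspace] by blast
  have explicit: "?P m x =
      (\<Prod>i=1..n-1. \<Sum>k=0..m i.
               (-1) ^ k * real (m i choose k)
               * pochhammer ((\<Sum>j=i+1..n. a j) + 2 * (\<Sum>j=i+1..n-1. real (m j)) + real k) (m i - k)
               * pochhammer (a i + real (m i) - real k) k
               * pochhammer (- x i) (m i - k)
               * pochhammer (- (\<Sum>j=i+1..n. x j) + (\<Sum>j=i+1..n-1. real (m j))) k)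
            * hyp3F2 (m 0)
                (- real (m 0))
                (real (m 0) + 2 * (\<Sum>j=1..n-1. real (m j)) + (\<Sum>i=1..n. a i) + b - 1)
                (- (\<Sum>i=1..n. x i) + (\<Sum>j=1..n-1. real (m j)))
                ((\<Sum>i=1..n. a i) + 2 * (\<Sum>j=1..n-1. real (m j)))
                (- real N + (\<Sum>j=1..n-1. real (m j)))
                1" for m x
    unfolding multi_hahn_def type_two_def hahn_def
    by (intro arg_cong2[where f = "(*)"] prod.cong sum.cong refl)
       (simp_all add: of_nat_diff add_ac add_diff_eq)
  have HT: "HT_op n N a b (?P m) =
      fscale ((\<Sum>j<n. real (m j)) * ((\<Sum>j<n. real (m j)) + (\<Sum>i=1..n. a i) + b - 1)) (?P m)"
    if "m \<in> ?M" for m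
    using HT_op_multi_hahn[OF assms(1) _ assms(3), of m N b] that
    by (simp add: fun_eq_iff fscale_def lattice_simplex_def)
  have H: "H_op n a i (?P m) =
      fscale ((\<Sum>j=i..n-1. real (m j)) * ((\<Sum>j=i..n-1. real (m j)) + (\<Sum>j=i..n. a j) - 1)) (?P m)"
    if "i \<in> {1..n-1}" for i m
    using H_op_multi_hahn[OF that] by (simp add: fun_eq_iff fscale_def)
  show ?thesis
    using inj indep span explicit HT H orth by blast
qed

end
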